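(* Let $d\ge 1$. Let $\mathbf{r}=(r_1,\ldots,r_d)\colon\mathbb{N}\to(0,\frac12)^d$, and let $\mu$ be a probability measure on $[0,1)^d$. Let $\mathcal{A}=(A_n)_{n\in\mathbb{N}}$ be a sequence of integral $d\times d$ matrices, and let $A_0$ be the $d\times d$ identity matrix. Assume that, for some $K>1$, we have $$\sigma(A_{n+1}A_n^{-1})\ge K\qquad(n\ge 0).$$ Assume also that there exists $s>d+1$ such that $$\widehat\mu(\mathbf{t})=O\big((\log|\mathbf{t}|_\infty)^{-s}\big)\quad\text{as }|\mathbf{t}|_\infty\to\infty.$$ Then, for $\mu$-almost all $\boldsymbol\alpha\in[0,1)^d$, $$\mathcal{L}^d\big(\mathcal{T}_{\boldsymbol\alpha}(\mathcal{A},\mathbf{r})\big)=\begin{cases}0,&\text{if }\sum_{n=1}^\infty\prod_{i=1}^d r_i(n)<\infty,\\ 1,&\text{if }\sum_{n=1}^\infty\prod_{i=1}^d r_i(n)=\infty.\end{cases}$$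
   Context: $\mathbb{N}=\{1,2,\ldots\}$. $\mathcal{L}^d$ is $d$-dimensional Lebesgue measure. $\|x\|$ denotes the distance from a real number $x$ to the nearest integer, and $|\mathbf{t}|_\infty=\max_i|t_i|$. For a $d\times d$ matrix $A$, $\sigma(A)=\inf\{\|Ax\|_2:\|x\|_2=1\}$ is its smallest singular value. (The condition $\sigma(A_{n+1}A_n^{-1})\ge K$ is understood to include invertibility of the matrices $A_n$ over $\mathbb{R}$.) The Fourier transform of a probability measure $\mu$ is $\widehat\mu(\mathbf{t})=\int e^{-2\pi i\langle \mathbf{t},\mathbf{x}\rangle}\,d\mu(\mathbf{x})$ for $\mathbf{t}\in\mathbb{R}^d$, where $\langle\mathbf{t},\mathbf{x}\rangle=t_1x_1+\cdots+t_dx_d$. $\mathcal{R}_n(\mathbf{r})=\{\mathbf{x}\in[0,1)^d:\|x_i\|\le r_i(n),\ 1\le i\le d\}$, and $$\mathcal{T}_{\boldsymbol\alpha}(\mathcal{A},\mathbf{r})=\{\boldsymbol\beta\in[0,1)^d: A_n\boldsymbol\alpha\in\boldsymbol\beta+\mathcal{R}_n(\mathbf{r})\ (\mathrm{mod}\ 1)\text{ for infinitely many } n\in\mathbb{N}\},$$ i.e. $\boldsymbol\beta$ belongs to this set iff for infinitely many $n$ one has $\|(A_n\boldsymbol\alpha)_i-\beta_i\|\le r_i(n)$ for all $1\le i\le d$. *)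

theory Defs
  imports "HOL-Probability.Probability" "HOL-Library.Landau_Symbols"
begin

definition unit_cube :: "(real ^ 'd) set" where
  "unit_cube = {x. \<forall>i. 0 \<le> x $ i \<and> x $ i < 1}"

definition int_dist :: "real \<Rightarrow> real" where
  "int_dist x = infdist x \<int>"

definition smallest_singular_value :: "real ^ 'd ^ 'd \<Rightarrow> real" where
  "smallest_singular_value A = Inf {norm (A *v x) | x. norm x = 1}"

abbreviation real_matrix :: "int ^ 'd ^ 'd \<Rightarrow> real ^ 'd ^ 'd" where
  "real_matrix A \<equiv> map_matrix real_of_int A"

definition fourier_transform :: "(real ^ 'd) measure \<Rightarrow> real ^ 'd \<Rightarrow> complex" where
  "fourier_transform \<mu> t =
     integral\<^sup>L \<mu> (\<lambda>x. exp (- 2 * complex_of_real pi * \<i> * complex_of_real (t \<bullet> x)))"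

definition target :: "(nat \<Rightarrow> real ^ 'd) \<Rightarrow> nat \<Rightarrow> (real ^ 'd) set" where
  "target r n = {x \<in> unit_cube. \<forall>i. int_dist (x $ i) \<le> r n $ i}"

definition cong_mod_1 :: "real ^ 'd \<Rightarrow> real ^ 'd \<Rightarrow> bool" where
  "cong_mod_1 x y \<longleftrightarrow> (\<forall>i. x $ i - y $ i \<in> \<int>)"

text \<open>The positive integers are the index set here: the matrix \<open>A 0\<close> and
  the vector \<open>r 0\<close> play no role in this set.\<close>

definition twisted_set ::
  "(nat \<Rightarrow> int ^ 'd ^ 'd) \<Rightarrow> (nat \<Rightarrow> real ^ 'd) \<Rightarrow> real ^ 'd \<Rightarrow> (real ^ 'd) set" where
  "twisted_set A r \<alpha> =
     {\<beta> \<in> unit_cube. infinite {n. n \<ge> 1 \<and>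
        (\<exists>\<rho> \<in> target r n. cong_mod_1 (real_matrix (A n) *v \<alpha>) (\<beta> + \<rho>))}}"

lemma int_dist_eq_round: "int_dist x = \<bar>x - of_int (round x)\<bar>"
  unfolding int_dist_def
proof (rule antisym)
  show "infdist x \<int> \<le> \<bar>x - of_int (round x)\<bar>"
    by (rule order_trans[OF infdist_le[of "of_int (round x)"]]) (auto simp: dist_real_def)
  have "\<bar>x - of_int (round x)\<bar> \<le> dist x k" if "k \<in> \<int>" for k
    using that round_diff_minimal[of x] by (auto simp: dist_real_def elim!: Ints_cases)
  moreover have "(\<int> :: real set) \<noteq> {}"
    using Ints_0 by blast
  ultimately show "\<bar>x - of_int (round x)\<bar> \<le> infdist x \<int>"
    by (auto simp: infdist_def intro!: cINF_greatest)
qed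

lemma int_dist_cong:
  assumes "x - y \<in> \<int>"
  shows "int_dist x = int_dist y"
proof -
  obtain k where k: "x = y + of_int k"
    using assms by (metis Ints_cases add.commute diff_add_cancel)
  have "round x = round y + k"
    unfolding k round_def by linarith
  then show ?thesis
    by (simp add: int_dist_eq_round k)
qed

lemma target_cong_iff:
  "(\<exists>\<rho> \<in> target r n. cong_mod_1 v (\<beta> + \<rho>)) \<longleftrightarrow> (\<forall>i. int_dist (v $ i - \<beta> $ i) \<le> r n $ i)"
proof
  assume "\<exists>\<rho> \<in> target r n. cong_mod_1 v (\<beta> + \<rho>)"
  then obtain \<rho> where \<rho>: "\<rho> \<in> target r n" "cong_mod_1 v (\<beta> + \<rho>)"
    by blast
  have "int_dist (v $ i - \<beta> $ i) = int_dist (\<rho> $ i)" for i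
    using \<rho>(2) by (intro int_dist_cong) (auto simp: cong_mod_1_def algebra_simps)
  then show "\<forall>i. int_dist (v $ i - \<beta> $ i) \<le> r n $ i"
    using \<rho>(1) by (auto simp: target_def)
next
  assume *: "\<forall>i. int_dist (v $ i - \<beta> $ i) \<le> r n $ i"
  define \<rho> :: "real ^ 'a" where "\<rho> = (\<chi> i. frac (v $ i - \<beta> $ i))"
  have "int_dist (\<rho> $ i) = int_dist (v $ i - \<beta> $ i)" for i
    by (intro int_dist_cong) (simp add: \<rho>_def frac_def)
  then have "\<rho> \<in> target r n"
    using * by (auto simp: target_def unit_cube_def \<rho>_def frac_lt_1)
  moreover have "cong_mod_1 v (\<beta> + \<rho>)"
    by (auto simp: cong_mod_1_def \<rho>_def frac_def)
  ultimately show "\<exists>\<rho> \<in> target r n. cong_mod_1 v (\<beta> + \<rho>)"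
    by blast
qed

end

theory Submission
  imports Defs "HOL-Real_Asymp.Real_Asymp"
begin

text \<open>
  Work on the product of \<open>\<mu>\<close> with Lebesgue measure on the cube, where the events are
  \<open>E n = {(\<alpha>, \<beta>). \<parallel>(A n \<alpha>)\<^sub>i - \<beta>\<^sub>i\<parallel> \<le> r\<^sub>i(n) for all i}\<close>. For a fixed \<open>\<alpha>\<close> the slice of \<open>E n\<close> is
  a box on the torus of volume \<open>\<Prod>i. 2 r\<^sub>i(n)\<close>, whatever \<open>\<alpha>\<close> is. The convergence half is therefore
  the first Borel--Cantelli lemma, applied for each \<open>\<alpha>\<close> separately. By Fubini, the divergence half
  says that almost every pair \<open>(\<alpha>, \<beta>)\<close> lies in infinitely many \<open>E n\<close>, and this follows from a
  second-moment argument once the \<open>E n\<close> are shown to be almost pairwise independent.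

  Averaging over \<open>\<beta>\<close> first is what makes the correlations accessible. For \<open>m < n\<close> the slices of
  \<open>E m\<close> and \<open>E n\<close> at \<open>\<alpha>\<close> overlap in volume \<open>\<Prod>i. h\<^sub>i((B \<alpha>)\<^sub>i)\<close> with \<open>B = A n - A m\<close>, where \<open>h\<^sub>i(y)\<close>
  is the length of the overlap of two arcs whose centres differ by \<open>y\<close>. This is a convolution of two
  indicators, so its Fourier coefficients are
  \<open>sin (2 \<pi> k r) sin (2 \<pi> k q) / (\<pi> k)\<^sup>2\<close>, and their absolute values add up to at most \<open>4/3\<close>
  (\<open>sum_abs_overlap_coeff_le\<close>). Integrating the product of the Fourier series against \<open>\<mu>\<close>, the zero
  frequency gives exactly the product of the two probabilities, while a frequency \<open>f \<noteq> 0\<close>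
  contributes its coefficient times the Fourier transform of \<open>\<mu>\<close> at \<open>B\<^sup>T f\<close>
  (\<open>integral_prod_arc_overlap\<close>).

  The singular value condition forces \<open>\<parallel>B\<^sup>T f\<parallel> \<ge> K\<^sup>n (1 - 1/K)\<close> (\<open>row_vector_difference_expands\<close>), so the
  logarithmic decay of the transform becomes a bound of order \<open>n\<^sup>-\<^sup>s\<close> on the correlation of \<open>E m\<close> and
  \<open>E n\<close>, uniformly in \<open>m < n\<close>. As \<open>s > 2\<close>, the sum of \<open>n \<cdot> n\<^sup>-\<^sup>s\<close> converges, and the number of
  events that occur up to time \<open>N\<close> has variance at most its mean plus a constant.
\<close>

section \<open>A second-moment Borel--Cantelli lemma\<close>

text \<open>The hypothesis makes the variance of the number of events that occur before time \<open>N\<close> at most its mean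
  plus a constant. If the mean tends to infinity, Chebyshev's inequality then rules out, up to a null
  set, that the count stays bounded.\<close>

lemma (in prob_space) AE_infinitely_often_if_almost_pairwise_independent:
  fixes E :: "nat \<Rightarrow> 'a set" and c :: "nat \<Rightarrow> real"
  assumes E [measurable]: "\<And>n. E n \<in> events"
    and div: "\<not> summable (\<lambda>n. prob (E n))"
    and c: "summable (\<lambda>n. real n * c n)"
    and corr: "\<And>m n. m < n \<Longrightarrow> prob (E m \<inter> E n) \<le> prob (E m) * prob (E n) + c n"
  shows "AE x in M. infinite {n. x \<in> E n}"
proof -
  define S :: "nat \<Rightarrow> 'a \<Rightarrow> real" where "S N x = (\<Sum>n<N. indicator (E n) x)" for N x
  define p where "p N = (\<Sum>n<N. prob (E n))" for N
  obtain C where C: "\<And>N. (\<Sum>n<N. 2 * (real n * c n)) \<le> C"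
  proof -
    have "convergent (\<lambda>N. \<Sum>n<N. 2 * (real n * c n))"
      using summable_mult[OF c, of 2] by (subst (asm) summable_iff_convergent)
    then have "Bseq (\<lambda>N. \<Sum>n<N. 2 * (real n * c n))"
      by (rule convergent_imp_Bseq)
    then show ?thesis
      using that by (auto simp: Bseq_def abs_le_iff)
  qed
  have [measurable]: "S N \<in> borel_measurable M" for N
    unfolding S_def by measurable
  have S_nonneg: "0 \<le> S N x" and S_le: "S N x \<le> real N" for N x
    using sum_bounded_above[of "{..<N}" "\<lambda>n. indicator (E n) x :: real" 1]
    by (auto simp: S_def intro!: sum_nonneg split: split_indicator)
  have int_bounded: "integrable M f" if "f \<in> borel_measurable M" "\<And>x. \<bar>f x\<bar> \<le> B"
    for f :: "'a \<Rightarrow> real" and B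
    using that by (intro integrable_const_bound[where B = B]) auto
  have int_S: "integrable M (S N)" for N
    using S_nonneg S_le by (intro int_bounded[of _ "real N"]) auto
  have int_ind: "integrable M (indicator A :: 'a \<Rightarrow> real)" if "A \<in> events" for A
    using that by (intro int_bounded[of _ 1]) (auto split: split_indicator)
  have int_sq: "integrable M (\<lambda>x. (S N x - p N)\<^sup>2)" for N
  proof (rule int_bounded[of _ "(real N + \<bar>p N\<bar>)\<^sup>2"])
    fix x
    have "\<bar>S N x - p N\<bar> \<le> real N + \<bar>p N\<bar>"
      using S_nonneg[of N x] S_le[of N x] by linarith
    then show "\<bar>(S N x - p N)\<^sup>2\<bar> \<le> (real N + \<bar>p N\<bar>)\<^sup>2"
      by (simp add: abs_le_square_iff[symmetric])
  qed measurable
  \<comment> \<open>Passing from \<open>N\<close> to \<open>N + 1\<close> adds one variance, at most \<open>prob (E N)\<close>, and twice the covariances of \<open>E N\<close> with the \<open>N\<close> earlier events, each at most \<open>c N\<close>.\<close>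
  have variance_bound: "expectation (\<lambda>x. (S N x - p N)\<^sup>2) \<le> p N + (\<Sum>n<N. 2 * (real n * c n))" for N
  proof (induction N)
    case 0
    show ?case by (simp add: S_def p_def)
  next
    case (Suc N)
    define q where "q = prob (E N)"
    define I :: "'a \<Rightarrow> real" where "I = indicator (E N)"
    define cross where "cross m x = indicator (E m \<inter> E N) x - q * indicator (E m) x
        - prob (E m) * I x + prob (E m) * q" for m x
    have int_cross: "integrable M (cross m)" for m
      unfolding cross_def I_def by (intro Bochner_Integration.integrable_add
        Bochner_Integration.integrable_diff integrable_mult_right int_ind) auto
    have E_cross: "expectation (cross m) = prob (E m \<inter> E N) - prob (E m) * q" for m
    proof -
      have "expectation (cross m) = prob (E m \<inter> E N) - q * prob (E m) - prob (E m) * q + prob (E m) * q"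
        unfolding cross_def I_def q_def
        by (simp add: int_ind prob_space)
      then show ?thesis by simp
    qed
    have product: "(S N x - p N) * (I x - q) = (\<Sum>m<N. cross m x)" for x
      unfolding S_def p_def sum_subtractf[symmetric] sum_distrib_right cross_def I_def
      by (intro sum.cong) (auto simp: algebra_simps split: split_indicator)
    have cross_bound: "expectation (\<lambda>x. \<Sum>m<N. cross m x) \<le> real N * c N"
    proof -
      have "expectation (\<lambda>x. \<Sum>m<N. cross m x) = (\<Sum>m<N. prob (E m \<inter> E N) - prob (E m) * q)"
        by (simp add: int_cross E_cross)
      also have "\<dots> \<le> (\<Sum>m<N. c N)"
        using corr by (intro sum_mono) (auto simp: q_def algebra_simps)
      finally show ?thesis by simp
    qed
    have "expectation (\<lambda>x. (I x - q)\<^sup>2) = expectation (\<lambda>x. (1 - 2 * q) * I x + q\<^sup>2)"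
      unfolding I_def by (intro Bochner_Integration.integral_cong)
        (auto simp: power2_eq_square algebra_simps split: split_indicator)
    also have "\<dots> = (1 - 2 * q) * q + q\<^sup>2"
      unfolding I_def q_def by (simp add: int_ind prob_space)
    also have "\<dots> \<le> q"
      by (simp add: power2_eq_square algebra_simps)
    finally have last: "expectation (\<lambda>x. (I x - q)\<^sup>2) \<le> q" .
    have int_last: "integrable M (\<lambda>x. (I x - q)\<^sup>2)"
    proof (rule int_bounded[of _ "1"])
      have "0 \<le> q" "q \<le> 1" by (auto simp: q_def)
      then show "\<bar>(I x - q)\<^sup>2\<bar> \<le> 1" for x
        by (auto simp: I_def abs_square_le_1 split: split_indicator)
    qed (auto simp: I_def)
    have "(S (Suc N) x - p (Suc N))\<^sup>2
        = (S N x - p N)\<^sup>2 + 2 * (\<Sum>m<N. cross m x) + (I x - q)\<^sup>2" for x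
      unfolding product[symmetric]
      by (simp add: S_def p_def I_def q_def power2_eq_square algebra_simps)
    then have "expectation (\<lambda>x. (S (Suc N) x - p (Suc N))\<^sup>2)
        = expectation (\<lambda>x. (S N x - p N)\<^sup>2) + 2 * expectation (\<lambda>x. \<Sum>m<N. cross m x)
          + expectation (\<lambda>x. (I x - q)\<^sup>2)"
      using int_sq[of N] int_last int_cross
      by (simp add: Bochner_Integration.integral_add)
    with Suc cross_bound last show ?case
      by (simp add: p_def q_def algebra_simps)
  qed
  \<comment> \<open>The exceptional set is the union over \<open>k\<close> of the sets \<open>F k\<close> on which at most \<open>k\<close> events ever occur.\<close>
  define F where "F k = {x \<in> space M. \<forall>N. S N x \<le> real k}" for k :: nat
  have [measurable]: "F k \<in> events" for k
    unfolding F_def by measurable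
  have p_at_top: "filterlim p at_top sequentially"
  proof -
    have "mono p"
      unfolding p_def by (intro monoI sum_mono2) auto
    have "\<exists>N. Z \<le> p N" for Z
      using div summableI_nonneg_bounded[of "\<lambda>n. prob (E n)" Z]
      by (force simp: p_def not_le intro: less_imp_le)
    then show ?thesis
      using \<open>mono p\<close> unfolding filterlim_at_top eventually_sequentially mono_def
      by (meson order_trans)
  qed
  have prob_F: "prob (F k) = 0" for k
  proof -
    have Chebyshev: "prob (F k) \<le> (p N + C) / (p N - real k)\<^sup>2" if "p N > real k" for N
    proof -
      have "prob (F k) * (p N - real k)\<^sup>2 = expectation (\<lambda>x. indicator (F k) x * (p N - real k)\<^sup>2)"
        by simp
      also have "\<dots> \<le> expectation (\<lambda>x. (S N x - p N)\<^sup>2)"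
      proof (rule integral_mono[OF _ int_sq])
        show "integrable M (\<lambda>x. indicator (F k) x * (p N - real k)\<^sup>2)"
          by (intro integrable_mult_left int_ind) auto
        show "indicator (F k) x * (p N - real k)\<^sup>2 \<le> (S N x - p N)\<^sup>2" for x
        proof (cases "x \<in> F k")
          case True
          then have "\<bar>p N - real k\<bar> \<le> \<bar>S N x - p N\<bar>"
            using that by (force simp: F_def abs_if not_less dest: spec[of _ N])
          with True show ?thesis
            by (simp add: abs_le_square_iff)
        qed simp
      qed
      also have "\<dots> \<le> p N + C"
        using variance_bound[of N] C[of N] by linarith
      finally show ?thesis
        using that by (simp add: field_simps)
    qed
    have "((\<lambda>t. (t + C) / (t - real k)\<^sup>2) \<longlongrightarrow> 0) at_top"
      by real_asymp
    then have lim: "(\<lambda>N. (p N + C) / (p N - real k)\<^sup>2) \<longlonglongrightarrow> 0"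
      using p_at_top by (rule filterlim_compose)
    have "eventually (\<lambda>N. p N > real k) sequentially"
      using p_at_top by (simp add: filterlim_at_top_dense)
    then have "eventually (\<lambda>N. prob (F k) \<le> (p N + C) / (p N - real k)\<^sup>2) sequentially"
      by eventually_elim (rule Chebyshev)
    then have "prob (F k) \<le> 0"
      by (intro tendsto_lowerbound[OF lim]) auto
    then show ?thesis
      by (simp add: measure_le_0_iff)
  qed
  have escape: "AE x in M. \<forall>k. x \<notin> F k"
    unfolding AE_all_countable
    using prob_F by (auto intro!: AE_not_in simp: null_sets_def emeasure_eq_measure)
  have exhaust: "\<exists>k. x \<in> F k" if "x \<in> space M" "finite {n. x \<in> E n}" for x
  proof
    have "S N x = card {n \<in> {..<N}. x \<in> E n}" for N
      by (simp add: S_def indicator_def sum.If_cases Int_def)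
    moreover have "card {n \<in> {..<N}. x \<in> E n} \<le> card {n. x \<in> E n}" for N
      using that by (intro card_mono) auto
    ultimately show "x \<in> F (card {n. x \<in> E n})"
      using that by (auto simp: F_def)
  qed
  show ?thesis
    using escape AE_space[of M] by eventually_elim (use exhaust in blast)
qed

section \<open>The Fourier series of the second periodic Bernoulli function\<close>

text \<open>Write \<open>e(x)\<close> for \<open>exp (2 \<pi> \<i> x)\<close>.
  The series \<open>\<Sum>n. cos (2 \<pi> n x) / n\<^sup>2\<close> is the real part of the dilogarithm on the unit circle. Inside
  the disc the derivative of the dilogarithm is a logarithm, and this is how the closed form is
  reached: integrate along circles of radius \<open>\<rho> < 1\<close> and let \<open>\<rho>\<close> tend to 1. The term for \<open>n = 0\<close>
  vanishes because division by zero gives zero.\<close>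

definition dilog :: "complex \<Rightarrow> complex" where
  "dilog z = (\<Sum>n. z ^ n / (of_nat n)\<^sup>2)"

lemma norm_dilog_term_le:
  assumes "norm z \<le> 1"
  shows "norm (z ^ n / (of_nat n :: complex)\<^sup>2) \<le> 1 / (real n)\<^sup>2"
  using assms by (simp add: norm_divide norm_power power_le_one divide_right_mono)

lemma summable_inverse_squares: "summable (\<lambda>n. 1 / (real n)\<^sup>2)"
  using inverse_power_summable[of 2, where 'a = real] by (simp add: inverse_eq_divide)

lemma summable_dilog: "norm z \<le> 1 \<Longrightarrow> summable (\<lambda>n. z ^ n / (of_nat n :: complex)\<^sup>2)"
  by (rule summable_comparison_test'[OF summable_inverse_squares]) (rule norm_dilog_term_le)

lemma continuous_on_dilog: "continuous_on (cball 0 1) dilog"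
proof -
  have "uniform_limit (cball 0 1) (\<lambda>n z. \<Sum>i<n. z ^ i / (of_nat i)\<^sup>2) (\<lambda>z. \<Sum>i. z ^ i / (of_nat i :: complex)\<^sup>2) sequentially"
    by (rule Weierstrass_m_test[OF norm_dilog_term_le summable_inverse_squares]) auto
  then show ?thesis
    unfolding dilog_def
    by (rule uniform_limit_theorem[rotated])
      (auto simp: divide_inverse intro!: always_eventually continuous_intros)
qed

text \<open>The derivative is described by its product with \<open>z\<close> because this is the quantity that the chain
  rule along a circle produces.\<close>

lemma has_field_derivative_dilog:
  assumes "norm z < 1"
  shows "\<exists>D. (dilog has_field_derivative D) (at z) \<and> D * z = - Ln (1 - z)"
proof -
  define c :: "nat \<Rightarrow> complex" where "c n = 1 / (of_nat n)\<^sup>2" for n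
  have diffs_c: "diffs c n = 1 / of_nat (Suc n)" for n
    by (simp add: diffs_def c_def power2_eq_square del: of_nat_Suc)
  have "((\<lambda>z. \<Sum>n. c n * z ^ n) has_field_derivative (\<Sum>n. diffs c n * z ^ n)) (at z)"
  proof (rule termdiffs_strong'[where K = 1])
    show "summable (\<lambda>n. c n * w ^ n)" if "norm w < 1" for w
      using summable_dilog[of w] that by (simp add: c_def)
  qed (use assms in auto)
  then have "(dilog has_field_derivative (\<Sum>n. diffs c n * z ^ n)) (at z)"
    by (simp add: c_def dilog_def[abs_def])
  moreover have "(\<Sum>n. diffs c n * z ^ n) * z = - Ln (1 - z)"
  proof -
    have "(\<lambda>n. - (z ^ n) / of_nat n) sums Ln (1 - z)"
      using Ln_series'[of "- z"] assms by simp
    from sums_minus[OF this] have "(\<lambda>n. z ^ n / of_nat n) sums (- Ln (1 - z))"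
      by simp
    then have *: "(\<lambda>n. z ^ Suc n / of_nat (Suc n)) sums (- Ln (1 - z))"
      by (subst sums_Suc_iff) simp
    show ?thesis
    proof (cases "z = 0")
      case False
      then have "(\<lambda>n. z ^ n / of_nat (Suc n)) sums (- Ln (1 - z) / z)"
        using sums_divide[OF *, of z] by (simp del: of_nat_Suc)
      then have "(\<Sum>n. diffs c n * z ^ n) = - Ln (1 - z) / z"
        unfolding diffs_c by (simp add: sums_iff del: of_nat_Suc)
      with False show ?thesis by simp
    qed simp
  qed
  ultimately show ?thesis by blast
qed

abbreviation circle_point :: "real \<Rightarrow> complex" where
  "circle_point x \<equiv> cis (2 * pi * x)"

text \<open>Along \<open>z = \<rho> e(x)\<close> one has \<open>dz/dx = 2 \<pi> \<i> z\<close>, which turns the real part of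
  \<open>dilog' z \<cdot> dz/dx = - 2 \<pi> \<i> Ln (1 - z)\<close> into an argument.\<close>

lemma Re_dilog_radius_derivative:
  assumes "0 \<le> \<rho>" "\<rho> < 1"
  shows "((\<lambda>x. Re (dilog (of_real \<rho> * circle_point x))) has_vector_derivative
           2 * pi * Im (Ln (1 - of_real \<rho> * circle_point x))) (at x within S)"
proof -
  define z where "z = of_real \<rho> * circle_point x"
  have "norm z < 1"
    using assms by (simp add: z_def norm_mult)
  then obtain D where D: "(dilog has_field_derivative D) (at z)" "D * z = - Ln (1 - z)"
    using has_field_derivative_dilog by blast
  define w where "w = (\<lambda>u. of_real \<rho> * exp (\<i> * (2 * of_real pi * u)))"
  have w: "w (of_real y) = of_real \<rho> * circle_point y" for y
    by (simp add: w_def cis_conv_exp)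
  have "(w has_field_derivative 2 * of_real pi * \<i> * z) (at (of_real x))"
    unfolding w_def by (rule derivative_eq_intros refl)+ (simp add: z_def cis_conv_exp)
  then have "((\<lambda>u. dilog (w u)) has_field_derivative D * (2 * of_real pi * \<i> * z)) (at (of_real x))"
    using D(1) w by (intro DERIV_chain2[where f = dilog]) (auto simp: z_def)
  then have "((\<lambda>y. dilog (w (of_real y))) has_vector_derivative D * (2 * of_real pi * \<i> * z)) (at x within S)"
    by (rule has_vector_derivative_real_field)
  then have "((\<lambda>y. Re (dilog (w (of_real y)))) has_vector_derivative Re (D * (2 * of_real pi * \<i> * z))) (at x within S)"
    by (rule bounded_linear.has_vector_derivative[OF bounded_linear_Re])
  moreover have "Re (D * (2 * of_real pi * \<i> * z)) = 2 * pi * Im (Ln (1 - z))"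
  proof -
    have eq: "D * (2 * of_real pi * \<i> * z) = 2 * of_real pi * \<i> * - Ln (1 - z)"
      unfolding D(2)[symmetric] by (simp only: mult_ac)
    show ?thesis
      unfolding eq by simp
  qed
  ultimately show ?thesis
    unfolding w by (simp only: z_def)
qed

text \<open>The chord identity \<open>1 - e(x) = 2 sin (\<pi> x) e((x - 1/2) / 2)\<close> exhibits the argument, which lies in
  the principal range for \<open>0 < x < 1\<close>.\<close>

lemma Im_Ln_one_minus_circle_point:
  assumes "0 < x" "x < 1"
  shows "Im (Ln (1 - circle_point x)) = pi * (x - 1 / 2)"
proof -
  have s: "0 < sin (pi * x)"
    using assms by (intro sin_gt_zero) auto
  have "of_real (2 * sin (pi * x)) * exp (\<i> * of_real (pi * (x - 1 / 2))) = 1 - circle_point x"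
  proof -
    have "1 - circle_point x = Complex (1 - cos (2 * (pi * x))) (- sin (2 * (pi * x)))"
      by (simp add: complex_eq_iff mult.assoc)
    also have "\<dots> = Complex (2 * sin (pi * x) * sin (pi * x)) (- (2 * sin (pi * x) * cos (pi * x)))"
      by (simp only: cos_double_sin sin_double) (simp add: power2_eq_square)
    also have "\<dots> = of_real (2 * sin (pi * x)) * cis (pi * x - pi / 2)"
      by (simp add: complex_eq_iff cos_diff sin_diff)
    finally show ?thesis
      by (simp add: cis_conv_exp algebra_simps)
  qed
  moreover from this s have "1 - circle_point x \<noteq> 0"
    by (metis exp_not_eq_zero less_irrefl mult_eq_0_iff of_real_eq_0_iff zero_neq_numeral)
  moreover have "pi * (- 1) < pi * (x - 1 / 2)" "pi * (x - 1 / 2) \<le> pi * 1"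
    using assms by (intro mult_strict_left_mono mult_left_mono; simp)+
  ultimately have "Arg (1 - circle_point x) = pi * (x - 1 / 2)"
    using s by (intro Arg_unique[where r = "2 * sin (pi * x)"]) auto
  then show ?thesis
    using \<open>1 - circle_point x \<noteq> 0\<close> by (simp add: Arg_eq_Im_Ln)
qed

text \<open>For \<open>\<rho> < 1\<close> the increment is the integral of \<open>2 \<pi> Im (Ln (1 - \<rho> e(x)))\<close>. These integrands are bounded
  by \<open>2 \<pi>\<^sup>2\<close> and converge to the linear function \<open>2 \<pi>\<^sup>2 (x - 1/2)\<close>, so the limit can be taken under
  the integral.\<close>

lemma Re_dilog_circle_diff:
  assumes "0 < a" "a \<le> b" "b < 1"
  shows "Re (dilog (circle_point b)) - Re (dilog (circle_point a)) = pi\<^sup>2 * ((b\<^sup>2 - b) - (a\<^sup>2 - a))"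
proof -
  define \<rho> where "\<rho> j = real j / real (Suc j)" for j
  have \<rho>: "0 \<le> \<rho> j" "\<rho> j < 1" for j
    by (auto simp: \<rho>_def)
  have \<rho>_lim: "\<rho> \<longlonglongrightarrow> 1"
    unfolding \<rho>_def using LIMSEQ_n_over_Suc_n by (simp add: divide_simps)
  have "((\<lambda>x. 2 * pi * (pi * (x - 1 / 2))) has_integral
      Re (dilog (circle_point b)) - Re (dilog (circle_point a))) {a..b}"
  proof (rule has_integral_dominated_convergence)
    show "((\<lambda>x. 2 * pi * Im (Ln (1 - of_real (\<rho> j) * circle_point x))) has_integral
       Re (dilog (of_real (\<rho> j) * circle_point b)) - Re (dilog (of_real (\<rho> j) * circle_point a))) {a..b}" for j
      using \<rho> assms by (intro fundamental_theorem_of_calculus Re_dilog_radius_derivative) auto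
    show "(\<lambda>x. 2 * pi * pi) integrable_on {a..b}"
      by (rule integrable_const_ivl)
    show "\<forall>x\<in>{a..b}. norm (2 * pi * Im (Ln (1 - of_real (\<rho> j) * circle_point x))) \<le> 2 * pi * pi" for j
    proof
      fix x
      have "norm (of_real (\<rho> j) * circle_point x) < 1"
        using \<rho>[of j] by (simp add: norm_mult)
      then have "1 - of_real (\<rho> j) * circle_point x \<noteq> 0"
        by (metis eq_iff_diff_eq_0 less_irrefl norm_one)
      then show "norm (2 * pi * Im (Ln (1 - of_real (\<rho> j) * circle_point x))) \<le> 2 * pi * pi"
        using mpi_less_Im_Ln[of "1 - of_real (\<rho> j) * circle_point x"]
          Im_Ln_le_pi[of "1 - of_real (\<rho> j) * circle_point x"]
        by (simp add: abs_mult)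
    qed
    show "\<forall>x\<in>{a..b}. (\<lambda>j. 2 * pi * Im (Ln (1 - of_real (\<rho> j) * circle_point x))) \<longlonglongrightarrow> 2 * pi * (pi * (x - 1 / 2))"
    proof
      fix x assume x: "x \<in> {a..b}"
      then have "0 < sin (pi * x)"
        using assms by (intro sin_gt_zero) auto
      then have "0 < Re (1 - circle_point x)"
        using cos_double_sin[of "pi * x"] by (simp add: mult.assoc)
      then have *: "1 - circle_point x \<notin> \<real>\<^sub>\<le>\<^sub>0"
        by (auto simp: complex_nonpos_Reals_iff)
      have "(\<lambda>j. 1 - of_real (\<rho> j) * circle_point x) \<longlonglongrightarrow> 1 - of_real 1 * circle_point x"
        by (intro tendsto_intros \<rho>_lim)
      with * have "(\<lambda>j. Im (Ln (1 - of_real (\<rho> j) * circle_point x))) \<longlonglongrightarrow> Im (Ln (1 - circle_point x))"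
        by (intro tendsto_Im tendsto_Ln) auto
      then show "(\<lambda>j. 2 * pi * Im (Ln (1 - of_real (\<rho> j) * circle_point x))) \<longlonglongrightarrow> 2 * pi * (pi * (x - 1 / 2))"
        using x assms by (intro tendsto_mult tendsto_const) (simp add: Im_Ln_one_minus_circle_point)
    qed
    have "(\<lambda>j. dilog (of_real (\<rho> j) * circle_point y)) \<longlonglongrightarrow> dilog (circle_point y)" for y
    proof (rule continuous_on_tendsto_compose[OF continuous_on_dilog])
      have "(\<lambda>j. of_real (\<rho> j) * circle_point y) \<longlonglongrightarrow> of_real 1 * circle_point y"
        by (intro tendsto_intros \<rho>_lim)
      then show "(\<lambda>j. of_real (\<rho> j) * circle_point y) \<longlonglongrightarrow> circle_point y"
        by simp
      show "\<forall>\<^sub>F j in sequentially. of_real (\<rho> j) * circle_point y \<in> cball 0 1"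
        using \<rho> by (auto simp: norm_mult less_imp_le)
    qed auto
    then show "(\<lambda>j. Re (dilog (of_real (\<rho> j) * circle_point b)) - Re (dilog (of_real (\<rho> j) * circle_point a)))
      \<longlonglongrightarrow> Re (dilog (circle_point b)) - Re (dilog (circle_point a))"
      by (intro tendsto_diff tendsto_Re)
  qed
  moreover have "((\<lambda>x. 2 * pi * (pi * (x - 1 / 2))) has_integral pi\<^sup>2 * (b\<^sup>2 - b) - pi\<^sup>2 * (a\<^sup>2 - a)) {a..b}"
    using assms(2) by (intro fundamental_theorem_of_calculus)
      (auto intro!: derivative_eq_intros simp: has_real_derivative_iff_has_vector_derivative[symmetric]
         power2_eq_square algebra_simps)
  ultimately show ?thesis
    by (auto dest: has_integral_unique simp: algebra_simps)
qed

text \<open>On \<open>[0, 1]\<close> this is \<open>(x\<^sup>2 - x + 1/6) / 2\<close>, half the second Bernoulli polynomial, continued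
  periodically. It serves as a continuous periodic antiderivative of the sawtooth \<open>frac x - 1/2\<close>.\<close>

definition cosine_series :: "real \<Rightarrow> real" where
  "cosine_series x = Re (dilog (circle_point x)) / (2 * pi\<^sup>2)"

lemma cosine_series_sums:
  "(\<lambda>n. cos (2 * pi * real n * x) / (2 * pi\<^sup>2 * (real n)\<^sup>2)) sums cosine_series x"
proof -
  have "(\<lambda>n. circle_point x ^ n / (of_nat n)\<^sup>2) sums dilog (circle_point x)"
    unfolding dilog_def by (intro summable_sums summable_dilog) simp
  then have "(\<lambda>n. Re (circle_point x ^ n / (of_nat n)\<^sup>2) / (2 * pi\<^sup>2)) sums cosine_series x"
    unfolding cosine_series_def by (intro sums_divide sums_Re)
  moreover have "Re (circle_point x ^ n / (of_nat n)\<^sup>2) / (2 * pi\<^sup>2)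
      = cos (2 * pi * real n * x) / (2 * pi\<^sup>2 * (real n)\<^sup>2)" for n
  proof -
    have "(of_nat n :: complex)\<^sup>2 = of_real ((real n)\<^sup>2)" by simp
    then show ?thesis
      by (simp only: Complex.DeMoivre Re_divide_of_real cis.sel) (simp add: mult_ac)
  qed
  ultimately show ?thesis by simp
qed

lemma continuous_on_cosine_series: "continuous_on S cosine_series"
  unfolding cosine_series_def
  by (intro continuous_intros continuous_on_compose2[OF continuous_on_dilog]) auto

lemma cosine_series_add_int: "cosine_series (x + of_int k) = cosine_series x"
proof -
  have "circle_point (x + of_int k) = circle_point x * cis (2 * pi * of_int k)"
    by (simp add: cis_mult algebra_simps)
  then show ?thesis
    by (simp add: cosine_series_def cis_multiple_2pi)
qed

text \<open>On each interval between consecutive integers, \<open>Re_dilog_circle_diff\<close> and periodicity determine the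
  function up to an additive constant.\<close>

lemma cosine_series_derivative:
  assumes "x \<notin> \<int>"
  shows "(cosine_series has_real_derivative frac x - 1 / 2) (at x)"
proof -
  define c where "c = cosine_series (1 / 2) + 1 / 8"
  have closed: "cosine_series y = (y\<^sup>2 - y) / 2 + c" if "0 < y" "y < 1" for y
  proof -
    have "Re (dilog (circle_point y)) - Re (dilog (circle_point (1 / 2)))
      = pi\<^sup>2 * ((y\<^sup>2 - y) - ((1 / 2)\<^sup>2 - 1 / 2))"
    proof (cases "y \<le> 1 / 2")
      case True
      then show ?thesis
        using Re_dilog_circle_diff[of y "1 / 2"] that by (simp add: algebra_simps)
    next
      case False
      then show ?thesis
        using Re_dilog_circle_diff[of "1 / 2" y] that by simp
    qed
    then show ?thesis
      by (simp add: cosine_series_def c_def field_simps power2_eq_square)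
  qed
  define k where "k = floor x"
  have k: "of_int k < x" "x < of_int k + 1"
    using assms floor_correct[of x] Ints_of_int[of "floor x", where 'a = real]
    by (auto simp: k_def less_le)
  have "((\<lambda>y. ((y - of_int k)\<^sup>2 - (y - of_int k)) / 2 + c) has_real_derivative frac x - 1 / 2) (at x)"
    by (auto intro!: derivative_eq_intros simp: frac_def k_def)
  moreover have "((y - of_int k)\<^sup>2 - (y - of_int k)) / 2 + c = cosine_series y"
    if "y \<in> {of_int k <..< of_int k + 1}" for y
    using closed[of "y - of_int k"] that cosine_series_add_int[of "y - of_int k" k] by simp
  ultimately show ?thesis
    using k by (elim has_field_derivative_transform_within_open[where S = "{of_int k <..< of_int k + 1}"]) auto
qed

section \<open>Overlaps of arcs on the circle\<close>

lemma int_dist_minus: "int_dist (- x) = int_dist x"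
proof -
  have "int_dist a \<le> int_dist (- a)" for a
    using round_diff_minimal[of a "- round (- a)"] by (simp add: int_dist_eq_round)
  from this[of x] this[of "- x"] show ?thesis by simp
qed

lemma int_dist_le_iff: "int_dist x \<le> r \<longleftrightarrow> (\<exists>k::int. \<bar>x - of_int k\<bar> \<le> r)"
  using round_diff_minimal[of x] unfolding int_dist_eq_round by (blast intro: order_trans)

lemma int_dist_eq_abs: "\<bar>x\<bar> \<le> 1 / 2 \<Longrightarrow> int_dist x = \<bar>x\<bar>"
proof (rule antisym)
  show "int_dist x \<le> \<bar>x\<bar>"
    using int_dist_le_iff[of x "\<bar>x\<bar>"] by (metis diff_zero of_int_0 order_refl)
  assume x: "\<bar>x\<bar> \<le> 1 / 2"
  show "\<bar>x\<bar> \<le> int_dist x"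
  proof -
    have "\<bar>x\<bar> \<le> \<bar>x - of_int k\<bar>" for k
    proof (cases "k = 0")
      case False
      then have "1 \<le> \<bar>of_int k :: real\<bar>"
        by linarith
      with x show ?thesis by linarith
    qed simp
    then show ?thesis by (simp add: int_dist_eq_round)
  qed
qed

text \<open>For \<open>x \<plusminus> r\<close> not integral, the number of integers between \<open>x - r\<close> and \<open>x + r\<close> is
  \<open>\<lfloor>x + r\<rfloor> - \<lfloor>x - r\<rfloor>\<close>; it is 0 or 1 because \<open>2 r < 1\<close>. This writes the indicator of an arc as a
  constant plus a difference of two sawtooth functions.\<close>

lemma arc_indicator_eq_frac:
  assumes r: "0 < r" "r < 1 / 2" and x: "x - r \<notin> \<int>" "x + r \<notin> \<int>"
  shows "2 * r + frac (x - r) - frac (x + r) = of_bool (int_dist x \<le> r)"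
proof -
  define m where "m = floor (x + r)"
  have m: "of_int m \<le> x + r" "x + r < of_int m + 1"
    unfolding m_def by linarith+
  show ?thesis
  proof (cases "x - r < of_int m")
    case True
    then have "floor (x - r) = m - 1"
      using m r by (intro floor_unique) auto
    moreover have "int_dist x \<le> r"
      unfolding int_dist_le_iff using True m by (intro exI[of _ m]) linarith
    ultimately show ?thesis
      by (simp add: frac_def m_def)
  next
    case False
    then have less: "of_int m < x - r"
      using x(1) Ints_of_int[of m] by (metis linorder_neqE)
    then have "floor (x - r) = m"
      using m r by (intro floor_unique) auto
    moreover have "\<not> int_dist x \<le> r"
    proof
      assume "int_dist x \<le> r"
      then obtain k :: int where k: "\<bar>x - of_int k\<bar> \<le> r"
        unfolding int_dist_le_iff by blast
      then have "m < k" "k < m + 1"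
        using less m by linarith+
      then show False by simp
    qed
    ultimately show ?thesis
      by (simp add: frac_def m_def)
  qed
qed

text \<open>The antiderivative fails to be differentiable only at the finitely many endpoints of arcs, which
  the fundamental theorem of calculus tolerates.\<close>

lemma has_integral_arc_indicator:
  assumes r: "0 < r" "r < 1 / 2" and ab: "a \<le> b"
  shows "((\<lambda>x. of_bool (int_dist (x - v) \<le> r)) has_integral
     2 * r * (b - a) + (cosine_series (b - v - r) - cosine_series (b - v + r))
       - (cosine_series (a - v - r) - cosine_series (a - v + r))) {a..b}"
proof -
  define G where "G x = 2 * r * x + cosine_series (x - v - r) - cosine_series (x - v + r)" for x
  define T where "T = {x \<in> {a..b}. x - v - r \<in> \<int> \<or> x - v + r \<in> \<int>}"
  have "T \<subseteq> (\<lambda>k. of_int k + (v + r)) ` {\<lfloor>a - v - r\<rfloor>..\<lceil>b - v - r\<rceil>}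
        \<union> (\<lambda>k. of_int k + (v - r)) ` {\<lfloor>a - v + r\<rfloor>..\<lceil>b - v + r\<rceil>}"
  proof
    fix x assume "x \<in> T"
    then have x: "a \<le> x" "x \<le> b" "x - v - r \<in> \<int> \<or> x - v + r \<in> \<int>"
      by (auto simp: T_def)
    from x(3) show "x \<in> (\<lambda>k. of_int k + (v + r)) ` {\<lfloor>a - v - r\<rfloor>..\<lceil>b - v - r\<rceil>}
        \<union> (\<lambda>k. of_int k + (v - r)) ` {\<lfloor>a - v + r\<rfloor>..\<lceil>b - v + r\<rceil>}"
    proof
      assume "x - v - r \<in> \<int>"
      then obtain k where k: "x - v - r = of_int k" by (elim Ints_cases)
      then have "k \<in> {\<lfloor>a - v - r\<rfloor>..\<lceil>b - v - r\<rceil>}" "x = of_int k + (v + r)"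
        using x(1,2) by (auto simp: floor_le_iff le_ceiling_iff)
      then show ?thesis by blast
    next
      assume "x - v + r \<in> \<int>"
      then obtain k where k: "x - v + r = of_int k" by (elim Ints_cases)
      then have "k \<in> {\<lfloor>a - v + r\<rfloor>..\<lceil>b - v + r\<rceil>}" "x = of_int k + (v - r)"
        using x(1,2) by (auto simp: floor_le_iff le_ceiling_iff)
      then show ?thesis by blast
    qed
  qed
  then have "finite T"
    by (rule finite_subset) auto
  moreover have "(G has_vector_derivative of_bool (int_dist (x - v) \<le> r)) (at x)"
    if "x \<in> {a<..<b} - T" for x
  proof -
    have x: "x - v - r \<notin> \<int>" "x - v + r \<notin> \<int>"
      using that by (auto simp: T_def)
    have "(G has_real_derivative 2 * r + (frac (x - v - r) - 1 / 2) - (frac (x - v + r) - 1 / 2)) (at x)"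
      unfolding G_def
      by (rule derivative_eq_intros refl DERIV_chain2[OF cosine_series_derivative] x | simp)+
    also have "2 * r + (frac (x - v - r) - 1 / 2) - (frac (x - v + r) - 1 / 2)
        = of_bool (int_dist (x - v) \<le> r)"
      using arc_indicator_eq_frac[OF r x] by simp
    finally show ?thesis
      by (simp add: has_real_derivative_iff_has_vector_derivative)
  qed
  moreover have "continuous_on {a..b} G"
    unfolding G_def
    by (intro continuous_intros continuous_on_compose2[OF continuous_on_cosine_series[of UNIV]]) auto
  ultimately have "((\<lambda>x. of_bool (int_dist (x - v) \<le> r)) has_integral G b - G a) {a..b}"
    using ab by (intro fundamental_theorem_of_calculus_interior_strong[of T]) auto
  then show ?thesis
    by (simp add: G_def algebra_simps)
qed

lemma has_integral_periodic_shift: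
  fixes f :: "real \<Rightarrow> real"
  assumes int: "(f has_integral I) {c..c + 1}" and per: "\<And>x (k::int). f (x + of_int k) = f x"
  shows "(f has_integral I) {0..1}"
proof -
  define t where "t = frac c"
  have t: "0 \<le> t" "t < 1"
    by (simp_all add: t_def frac_lt_1)
  have shift: "c - of_int (floor c) = t" "c + 1 - of_int (floor c) = t + 1"
    by (simp_all add: t_def frac_def)
  have "((\<lambda>x. f (x + of_int (floor c))) has_integral I) {c - of_int (floor c)..c + 1 - of_int (floor c)}"
    by (rule has_integral_shift_real_ivl[OF int])
  then have I: "(f has_integral I) {t..t + 1}"
    unfolding shift per .
  define p where "p = integral {t..1} f"
  define q where "q = integral {1..t + 1} f"
  have p: "(f has_integral p) {t..1}" and q: "(f has_integral q) {1..t + 1}"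
    unfolding p_def q_def using t I
    by (auto intro!: integrable_integral intro: integrable_subinterval_real[OF has_integral_integrable[OF I]])
  have "I = p + q"
    using has_integral_combine[OF _ _ p q] t I by (auto intro: has_integral_unique)
  have "((\<lambda>x. f (x + of_int 1)) has_integral q) {1 - of_int 1..t + 1 - of_int 1}"
    by (rule has_integral_shift_real_ivl[OF q])
  then have "(f has_integral q) {0..t}"
    unfolding per by simp
  from has_integral_combine[OF _ _ this p] t show ?thesis
    by (simp add: \<open>I = p + q\<close> add.commute)
qed

lemma int_dist_periodic:
  "int_dist (x + of_int k - v) = int_dist (x - v)"
  by (rule int_dist_cong) simp

lemma has_integral_arc:
  assumes "0 < r" "r < 1 / 2"
  shows "((\<lambda>x. of_bool (int_dist (x - v) \<le> r)) has_integral 2 * r) {0..1}"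
  using has_integral_arc_indicator[OF assms, of 0 1 v]
    cosine_series_add_int[of "- v - r" 1] cosine_series_add_int[of "- v + r" 1]
  by (simp add: algebra_simps)

text \<open>The closed form for the length of the overlap of two arcs of half-widths \<open>r\<close> and \<open>q\<close> on the circle
  \<open>\<real>/\<int>\<close> whose centres differ by \<open>y\<close>; see \<open>has_integral_arc_overlap\<close>. It is a second difference of the
  antiderivative of the sawtooth, which is how its Fourier series becomes visible.\<close>

definition arc_overlap :: "real \<Rightarrow> real \<Rightarrow> real \<Rightarrow> real" where
  "arc_overlap r q y = 4 * r * q
     + cosine_series (y + q - r) - cosine_series (y + q + r)
     - cosine_series (y - q - r) + cosine_series (y - q + r)"

text \<open>Over the period centred at \<open>w\<close>, the second arc is the interval from \<open>w - q\<close> to \<open>w + q\<close>, and the integral of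
  the first indicator over that interval is known.\<close>

lemma has_integral_arc_overlap:
  assumes r: "0 < r" "r < 1 / 2" and q: "0 < q" "q < 1 / 2"
  shows "((\<lambda>x. of_bool (int_dist (x - v) \<le> r \<and> int_dist (x - w) \<le> q))
           has_integral arc_overlap r q (w - v)) {0..1}"
proof (rule has_integral_periodic_shift[where c = "w - 1 / 2"])
  have "((\<lambda>x. of_bool (int_dist (x - v) \<le> r)) has_integral arc_overlap r q (w - v)) {w - q..w + q}"
    using has_integral_arc_indicator[OF r, of "w - q" "w + q" v] q
    by (simp add: arc_overlap_def algebra_simps)
  then have "((\<lambda>x. if x \<in> {w - q..w + q} then of_bool (int_dist (x - v) \<le> r) else 0 :: real)
      has_integral arc_overlap r q (w - v)) {w - 1 / 2..w - 1 / 2 + 1}"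
    using q by (subst has_integral_restrict) auto
  then show "((\<lambda>x. of_bool (int_dist (x - v) \<le> r \<and> int_dist (x - w) \<le> q)) has_integral arc_overlap r q (w - v))
     {w - 1 / 2..w - 1 / 2 + 1}"
  proof (rule has_integral_eq[rotated])
    fix x assume "x \<in> {w - 1 / 2..w - 1 / 2 + 1}"
    then have "\<bar>x - w\<bar> \<le> 1 / 2"
      unfolding abs_le_iff by simp
    then have "int_dist (x - w) = \<bar>x - w\<bar>"
      by (rule int_dist_eq_abs)
    then show "(if x \<in> {w - q..w + q} then of_bool (int_dist (x - v) \<le> r) else 0 :: real)
        = of_bool (int_dist (x - v) \<le> r \<and> int_dist (x - w) \<le> q)"
      by (auto simp: abs_le_iff)
  qed
qed (simp add: int_dist_periodic)

text \<open>The Fourier coefficients of \<open>arc_overlap r q\<close>: the overlap is the convolution of the two indicators,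
  so its coefficients are the products of theirs.\<close>

definition overlap_coeff :: "real \<Rightarrow> real \<Rightarrow> int \<Rightarrow> real" where
  "overlap_coeff r q k = (if k = 0 then 4 * r * q
     else sin (2 * pi * of_int k * r) * sin (2 * pi * of_int k * q) / (pi * of_int k)\<^sup>2)"

lemma arc_overlap_sums:
  "(\<lambda>n. 2 * overlap_coeff r q (int (Suc n)) * cos (2 * pi * real (Suc n) * y))
     sums (arc_overlap r q y - 4 * r * q)"
proof -
  define f where "f n z = cos (2 * pi * real n * z) / (2 * pi\<^sup>2 * (real n)\<^sup>2)" for n z
  have "(\<lambda>n. f (Suc n) z) sums cosine_series z" for z
    using cosine_series_sums[of z] by (subst sums_Suc_iff) (simp add: f_def)
  then have "(\<lambda>n. f (Suc n) (y + q - r) - f (Suc n) (y + q + r)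
       - f (Suc n) (y - q - r) + f (Suc n) (y - q + r)) sums (arc_overlap r q y - 4 * r * q)"
    unfolding arc_overlap_def
    by (auto intro!: sums_add sums_diff simp: algebra_simps) 
  moreover have "f (Suc n) (y + q - r) - f (Suc n) (y + q + r)
       - f (Suc n) (y - q - r) + f (Suc n) (y - q + r)
     = 2 * overlap_coeff r q (int (Suc n)) * cos (2 * pi * real (Suc n) * y)" for n
  proof -
    define \<theta> a b where "\<theta> = 2 * pi * real (Suc n) * y" and "a = 2 * pi * real (Suc n) * q"
      and "b = 2 * pi * real (Suc n) * r"
    have "cos (\<theta> + a - b) - cos (\<theta> + a + b) - cos (\<theta> - a - b) + cos (\<theta> - a + b)
        = 4 * cos \<theta> * sin a * sin b"
      by (simp add: cos_add cos_diff sin_add sin_diff algebra_simps)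
    then have "(cos (\<theta> + a - b) - cos (\<theta> + a + b) - cos (\<theta> - a - b) + cos (\<theta> - a + b))
        / (2 * pi\<^sup>2 * (real (Suc n))\<^sup>2) = 2 * (sin b * sin a / (pi * real (Suc n))\<^sup>2) * cos \<theta>"
      by (simp add: power_mult_distrib field_simps del: of_nat_Suc)
    moreover have "2 * pi * real (Suc n) * (y + q - r) = \<theta> + a - b"
      "2 * pi * real (Suc n) * (y + q + r) = \<theta> + a + b"
      "2 * pi * real (Suc n) * (y - q - r) = \<theta> - a - b"
      "2 * pi * real (Suc n) * (y - q + r) = \<theta> - a + b"
      by (simp_all add: \<theta>_def a_def b_def algebra_simps)
    ultimately show ?thesis
      unfolding f_def by (simp add: overlap_coeff_def a_def b_def \<theta>_def diff_divide_distrib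
        add_divide_distrib del: of_nat_Suc)
  qed
  ultimately show ?thesis by simp
qed

lemma sum_symmetric_int_interval:
  fixes g :: "int \<Rightarrow> 'a :: comm_monoid_add"
  shows "sum g {- int N..int N} = g 0 + (\<Sum>n<N. g (int (Suc n)) + g (- int (Suc n)))"
proof (induction N)
  case (Suc N)
  have "{- int (Suc N)..int (Suc N)} = insert (int (Suc N)) (insert (- int (Suc N)) {- int N..int N})"
    by auto
  then have "sum g {- int (Suc N)..int (Suc N)} = g (int (Suc N)) + (g (- int (Suc N)) + sum g {- int N..int N})"
    by simp
  with Suc show ?case by (simp add: ac_simps)
qed simp

lemma overlap_coeff_minus: "overlap_coeff r q (- k) = overlap_coeff r q k"
  by (simp add: overlap_coeff_def)

lemma arc_overlap_Fourier_series:
  "(\<lambda>N. \<Sum>k\<in>{- int N..int N}. of_real (overlap_coeff r q k) * cis (- (2 * pi * of_int k * y)))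
     \<longlonglongrightarrow> of_real (arc_overlap r q y)"
proof -
  have "(\<Sum>k\<in>{- int N..int N}. of_real (overlap_coeff r q k) * cis (- (2 * pi * of_int k * y)))
     = of_real (4 * r * q + (\<Sum>n<N. 2 * overlap_coeff r q (int (Suc n)) * cos (2 * pi * real (Suc n) * y)))"
    for N
  proof -
    have "of_real (overlap_coeff r q (int (Suc n))) * cis (- (2 * pi * of_int (int (Suc n)) * y))
       + of_real (overlap_coeff r q (- int (Suc n))) * cis (- (2 * pi * of_int (- int (Suc n)) * y))
       = of_real (2 * overlap_coeff r q (int (Suc n)) * cos (2 * pi * real (Suc n) * y))" for n
    proof -
      have "2 * pi * of_int (int (Suc n)) * y = 2 * pi * real (Suc n) * y"
        "2 * pi * of_int (- int (Suc n)) * y = - (2 * pi * real (Suc n) * y)"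
        by (simp_all only: of_int_minus of_int_of_nat_eq mult_minus_right mult_minus_left)
      then show ?thesis
        unfolding overlap_coeff_minus by (simp only: complex_eq_iff) (simp del: of_nat_Suc)
    qed
    then show ?thesis
      unfolding sum_symmetric_int_interval by (simp add: overlap_coeff_def[of r q 0])
  qed
  moreover have "(\<lambda>N. 4 * r * q + (\<Sum>n<N. 2 * overlap_coeff r q (int (Suc n)) * cos (2 * pi * real (Suc n) * y)))
      \<longlonglongrightarrow> 4 * r * q + (arc_overlap r q y - 4 * r * q)"
    using arc_overlap_sums[of r q y] by (intro tendsto_add tendsto_const) (simp add: sums_def)
  ultimately show ?thesis
    by (simp only: tendsto_of_real_iff) simp
qed

text \<open>Each coefficient \<open>k \<noteq> 0\<close> is at most \<open>1 / (\<pi> k)\<^sup>2\<close>, so together they contribute at most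
  \<open>2 / \<pi>\<^sup>2 \<cdot> \<pi>\<^sup>2 / 6 = 1/3\<close>, and the coefficient \<open>4 r q\<close> is at most 1. What matters is that
  the bound is uniform in the half-widths.\<close>

lemma sum_abs_overlap_coeff_le:
  assumes r: "0 < r" "r < 1 / 2" and q: "0 < q" "q < 1 / 2"
  shows "(\<Sum>k\<in>{- int N..int N}. \<bar>overlap_coeff r q k\<bar>) \<le> 4 / 3"
proof -
  have "2 * \<bar>overlap_coeff r q (int (Suc n))\<bar> \<le> 2 / pi\<^sup>2 * (1 / real ((n + 1)\<^sup>2))" for n
  proof -
    have "\<bar>sin a * sin b\<bar> \<le> 1" for a b :: real
      by (simp add: abs_mult mult_le_one)
    then show ?thesis
      by (simp add: overlap_coeff_def abs_divide power_mult_distrib divide_right_mono del: of_nat_Suc)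
  qed
  then have "(\<Sum>n<N. 2 * \<bar>overlap_coeff r q (int (Suc n))\<bar>) \<le> (\<Sum>n<N. 2 / pi\<^sup>2 * (1 / real ((n + 1)\<^sup>2)))"
    by (intro sum_mono)
  also have "\<dots> \<le> 2 / pi\<^sup>2 * (pi\<^sup>2 / 6)"
    unfolding sum_distrib_left[symmetric]
    using sum_le_suminf[of "\<lambda>n. 1 / real ((n + 1)\<^sup>2)" "{..<N}"] inverse_squares_sums
    by (intro mult_left_mono) (auto simp: sums_iff)
  also have "\<dots> = 1 / 3" by simp
  finally have "(\<Sum>n<N. 2 * \<bar>overlap_coeff r q (int (Suc n))\<bar>) \<le> 1 / 3" .
  moreover have "\<bar>overlap_coeff r q 0\<bar> \<le> 1"
    using mult_mono[of "2 * r" 1 "2 * q" 1] r q by (simp add: overlap_coeff_def abs_mult)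
  ultimately show ?thesis
    unfolding sum_symmetric_int_interval overlap_coeff_minus by simp
qed

section \<open>Integrals of overlap volumes against a measure\<close>

lemma norm_fourier_transform_le_1:
  assumes "prob_space \<mu>"
  shows "cmod (fourier_transform \<mu> t) \<le> 1"
proof -
  interpret prob_space \<mu> by fact
  have "cmod (fourier_transform \<mu> t)
      \<le> (LINT x|\<mu>. cmod (exp (- 2 * complex_of_real pi * \<i> * complex_of_real (t \<bullet> x))))"
    unfolding fourier_transform_def by (rule integral_norm_bound)
  also have "\<dots> = 1"
    by (simp add: norm_exp_eq_Re prob_space)
  finally show ?thesis .
qed

lemma fourier_transform_eq_cis:
  "fourier_transform \<mu> t = (LINT x|\<mu>. cis (- (2 * pi * (t \<bullet> x))))"
  unfolding fourier_transform_def cis_conv_exp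
  by (intro Bochner_Integration.integral_cong refl arg_cong[of _ _ exp]) (simp add: mult_ac)

lemma abs_arc_overlap_le:
  assumes r: "0 < r" "r < 1 / 2" and q: "0 < q" "q < 1 / 2"
  shows "\<bar>arc_overlap r q y\<bar> \<le> 4 / 3"
proof -
  have "norm (\<Sum>k\<in>{- int N..int N}. of_real (overlap_coeff r q k) * cis (- (2 * pi * of_int k * y))) \<le> 4 / 3"
    for N
    using sum_abs_overlap_coeff_le[OF assms] by (intro order_trans[OF norm_sum]) (simp add: norm_mult)
  moreover note arc_overlap_Fourier_series[of r q y]
  ultimately have "norm (of_real (arc_overlap r q y) :: complex) \<le> 4 / 3"
    by (intro Lim_norm_ubound[of sequentially]) auto
  then show ?thesis by simp
qed

lemma borel_measurable_arc_overlap [measurable]: "arc_overlap r q \<in> borel_measurable borel"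
  unfolding arc_overlap_def
  by (intro borel_measurable_continuous_onI continuous_intros
      continuous_on_compose2[OF continuous_on_cosine_series[of UNIV]]) auto

text \<open>The coupling between different coordinates is handled by expanding the product of the truncated
  Fourier series into characters \<open>\<alpha> \<mapsto> e(- \<langle>f, B \<alpha>\<rangle>)\<close>, whose integrals are values of the Fourier
  transform at \<open>B\<^sup>T f\<close>. The zero frequency yields the main term; all others are bounded by \<open>\<delta>\<close> times
  the sum of the coefficients, which factorises over the coordinates. Dominated convergence removes
  the truncation.\<close>

lemma integral_prod_arc_overlap:
  fixes \<mu> :: "(real ^ 'd) measure" and B :: "real ^ 'd ^ 'd" and r q :: "'d \<Rightarrow> real"
  assumes \<mu>: "prob_space \<mu>" and sets: "sets \<mu> = sets (restrict_space borel S)"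
    and r: "\<And>i. 0 < r i \<and> r i < 1 / 2" and q: "\<And>i. 0 < q i \<and> q i < 1 / 2"
    and decay: "\<And>f :: 'd \<Rightarrow> int. f \<noteq> (\<lambda>_. 0) \<Longrightarrow>
      cmod (fourier_transform \<mu> ((\<chi> i. of_int (f i)) v* B)) \<le> \<delta>"
  shows "\<bar>(LINT \<alpha>|\<mu>. (\<Prod>i\<in>UNIV. arc_overlap (r i) (q i) ((B *v \<alpha>) $ i))) - (\<Prod>i\<in>UNIV. 4 * r i * q i)\<bar>
    \<le> (4 / 3) ^ CARD('d) * \<delta>"
proof -
  interpret prob_space \<mu> by fact
  have \<delta>: "0 \<le> \<delta>"
    using decay[of "\<lambda>_. 1"] by (auto simp: fun_eq_iff intro: order_trans[OF norm_ge_zero])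
  have meas: "f \<in> measurable \<mu> N" if "f \<in> measurable borel N" for f :: "real ^ 'd \<Rightarrow> 'a" and N
    using measurable_restrict_space1[OF that, of S] measurable_cong_sets[OF sets refl] by auto
  have cont_B: "continuous_on UNIV (\<lambda>\<alpha>. (B *v \<alpha>) $ i)" for i
    by (intro continuous_intros linear_continuous_on) (auto simp: linear_linear intro: matrix_vector_mul_bounded_linear)
  have [measurable]: "(\<lambda>\<alpha>. (B *v \<alpha>) $ i) \<in> borel_measurable \<mu>" for i
    by (intro meas borel_measurable_continuous_onI cont_B)
  define F where "F N = PiE UNIV (\<lambda>_::'d. {- int N..int N})" for N
  have fin_F: "finite (F N)" for N
    unfolding F_def by (intro finite_PiE) auto
  define c where "c f = (\<Prod>i\<in>UNIV. overlap_coeff (r i) (q i) (f i))" for f :: "'d \<Rightarrow> int"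
  define v where "v f = (\<chi> i. of_int (f i)) v* B" for f :: "'d \<Rightarrow> int"
  define P where "P N i y = (\<Sum>k\<in>{- int N..int N}. of_real (overlap_coeff (r i) (q i) k)
      * cis (- (2 * pi * of_int k * y)))" for N i y
  have P_le: "norm (P N i y) \<le> 4 / 3" for N i y
    unfolding P_def using r q
      sum_abs_overlap_coeff_le[of "r i" "q i"]
    by (intro order_trans[OF norm_sum]) (simp add: norm_mult)
  have c_sum: "(\<Sum>f\<in>F N. \<bar>c f\<bar>) \<le> (4 / 3) ^ CARD('d)" for N
  proof -
    have "(\<Sum>f\<in>F N. \<bar>c f\<bar>) = (\<Prod>i\<in>UNIV. \<Sum>k\<in>{- int N..int N}. \<bar>overlap_coeff (r i) (q i) k\<bar>)"
      unfolding c_def F_def abs_prod by (rule prod_sum_PiE[symmetric]) auto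
    also have "\<dots> \<le> (\<Prod>i\<in>(UNIV :: 'd set). 4 / 3)"
      using r q by (intro prod_mono conjI sum_nonneg sum_abs_overlap_coeff_le) auto
    finally show ?thesis by simp
  qed
  have expand: "(\<Prod>i\<in>UNIV. P N i ((B *v \<alpha>) $ i)) = (\<Sum>f\<in>F N. of_real (c f) * cis (- (2 * pi * (v f \<bullet> \<alpha>))))"
    for N \<alpha>
  proof -
    have "(\<Prod>i\<in>UNIV. P N i ((B *v \<alpha>) $ i)) = (\<Sum>f\<in>F N. \<Prod>i\<in>UNIV.
        of_real (overlap_coeff (r i) (q i) (f i)) * cis (- (2 * pi * of_int (f i) * (B *v \<alpha>) $ i)))"
      unfolding P_def F_def by (rule prod_sum_PiE) auto
    also have "\<dots> = (\<Sum>f\<in>F N. of_real (c f) * cis (- (2 * pi * (v f \<bullet> \<alpha>))))"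
    proof (rule sum.cong[OF refl])
      fix f :: "'d \<Rightarrow> int"
      have "v f \<bullet> \<alpha> = (\<Sum>i\<in>UNIV. of_int (f i) * (B *v \<alpha>) $ i)"
        unfolding v_def dot_lmul_matrix by (simp add: inner_vec_def)
      then have "- (2 * pi * (v f \<bullet> \<alpha>)) = (\<Sum>i\<in>UNIV. - (2 * pi * of_int (f i) * (B *v \<alpha>) $ i))"
        by (simp add: sum_distrib_left sum_negf mult.assoc)
      moreover have "(\<Prod>i\<in>UNIV. cis (- (2 * pi * of_int (f i) * (B *v \<alpha>) $ i)))
          = cis (\<Sum>i\<in>UNIV. - (2 * pi * of_int (f i) * (B *v \<alpha>) $ i))"
        unfolding cis_conv_exp by (simp add: exp_sum sum_distrib_left)
      ultimately show "(\<Prod>i\<in>UNIV. of_real (overlap_coeff (r i) (q i) (f i))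
          * cis (- (2 * pi * of_int (f i) * (B *v \<alpha>) $ i))) = of_real (c f) * cis (- (2 * pi * (v f \<bullet> \<alpha>)))"
        by (simp only: prod.distrib c_def of_real_prod)
    qed
    finally show ?thesis .
  qed
  have int_cis: "integrable \<mu> (\<lambda>\<alpha>. cis (- (2 * pi * (t \<bullet> \<alpha>))))" for t
    by (intro integrable_const_bound[where B = 1] meas) (auto simp: cis_conv_exp)
  have integral_P: "(LINT \<alpha>|\<mu>. (\<Prod>i\<in>UNIV. P N i ((B *v \<alpha>) $ i)))
     = (\<Sum>f\<in>F N. of_real (c f) * fourier_transform \<mu> (v f))" for N
    unfolding expand fourier_transform_eq_cis
    by (subst Bochner_Integration.integral_sum) (auto intro!: integrable_mult_right int_cis simp: int_cis)
  have finite_bound: "cmod ((LINT \<alpha>|\<mu>. (\<Prod>i\<in>UNIV. P N i ((B *v \<alpha>) $ i))) - of_real (\<Prod>i\<in>UNIV. 4 * r i * q i))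
      \<le> (4 / 3) ^ CARD('d) * \<delta>" for N
  proof -
    have "(\<lambda>_. 0) \<in> F N"
      by (auto simp: F_def)
    moreover have "v (\<lambda>_. 0) = 0"
      by (simp add: v_def zero_vec_def[symmetric])
    then have "of_real (c (\<lambda>_. 0)) * fourier_transform \<mu> (v (\<lambda>_. 0)) = of_real (\<Prod>i\<in>UNIV. 4 * r i * q i)"
      by (simp add: c_def overlap_coeff_def fourier_transform_def prob_space)
    ultimately have "(LINT \<alpha>|\<mu>. (\<Prod>i\<in>UNIV. P N i ((B *v \<alpha>) $ i))) - of_real (\<Prod>i\<in>UNIV. 4 * r i * q i)
       = (\<Sum>f\<in>F N - {\<lambda>_. 0}. of_real (c f) * fourier_transform \<mu> (v f))"
      unfolding integral_P by (simp add: sum.remove[OF fin_F])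
    also have "cmod \<dots> \<le> (\<Sum>f\<in>F N - {\<lambda>_. 0}. \<bar>c f\<bar> * \<delta>)"
      using decay by (intro sum_norm_le) (auto simp: norm_mult v_def intro!: mult_left_mono)
    also have "\<dots> \<le> (\<Sum>f\<in>F N. \<bar>c f\<bar> * \<delta>)"
      using \<delta> fin_F by (intro sum_mono2) auto
    also have "\<dots> \<le> (4 / 3) ^ CARD('d) * \<delta>"
      using c_sum \<delta> by (simp add: sum_distrib_right[symmetric] mult_right_mono)
    finally show ?thesis .
  qed
  have "(\<lambda>N. LINT \<alpha>|\<mu>. (\<Prod>i\<in>UNIV. P N i ((B *v \<alpha>) $ i)))
      \<longlonglongrightarrow> (LINT \<alpha>|\<mu>. of_real (\<Prod>i\<in>UNIV. arc_overlap (r i) (q i) ((B *v \<alpha>) $ i)))"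
  proof (rule integral_dominated_convergence[where w = "\<lambda>_. (4 / 3) ^ CARD('d)"])
    show "AE \<alpha> in \<mu>. (\<lambda>N. \<Prod>i\<in>UNIV. P N i ((B *v \<alpha>) $ i))
        \<longlonglongrightarrow> of_real (\<Prod>i\<in>UNIV. arc_overlap (r i) (q i) ((B *v \<alpha>) $ i))"
      unfolding P_def of_real_prod by (intro AE_I2 tendsto_prod arc_overlap_Fourier_series)
    show "AE \<alpha> in \<mu>. norm (\<Prod>i\<in>UNIV. P N i ((B *v \<alpha>) $ i)) \<le> (4 / 3) ^ CARD('d)" for N
    proof (rule AE_I2)
      fix \<alpha>
      have "norm (\<Prod>i\<in>UNIV. P N i ((B *v \<alpha>) $ i)) \<le> (\<Prod>i\<in>(UNIV :: 'd set). 4 / 3)"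
        unfolding prod_norm[symmetric] by (intro prod_mono conjI P_le norm_ge_zero)
      then show "norm (\<Prod>i\<in>UNIV. P N i ((B *v \<alpha>) $ i)) \<le> (4 / 3) ^ CARD('d)"
        by simp
    qed
    show "(\<lambda>\<alpha>. \<Prod>i\<in>UNIV. P N i ((B *v \<alpha>) $ i)) \<in> borel_measurable \<mu>" for N
      unfolding P_def cis_conv_exp by measurable
  qed auto
  then have "(\<lambda>N. (LINT \<alpha>|\<mu>. (\<Prod>i\<in>UNIV. P N i ((B *v \<alpha>) $ i))) - of_real (\<Prod>i\<in>UNIV. 4 * r i * q i))
      \<longlonglongrightarrow> of_real ((LINT \<alpha>|\<mu>. (\<Prod>i\<in>UNIV. arc_overlap (r i) (q i) ((B *v \<alpha>) $ i))) - (\<Prod>i\<in>UNIV. 4 * r i * q i))"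
    by (intro tendsto_eq_intros) (auto simp: simp del: of_real_prod)
  from Lim_norm_ubound[OF _ this, of "(4 / 3) ^ CARD('d) * \<delta>"] finite_bound
  have "norm (of_real ((LINT \<alpha>|\<mu>. (\<Prod>i\<in>UNIV. arc_overlap (r i) (q i) ((B *v \<alpha>) $ i))) - (\<Prod>i\<in>UNIV. 4 * r i * q i)) :: complex)
     \<le> (4 / 3) ^ CARD('d) * \<delta>"
    by simp
  then show ?thesis
    unfolding norm_of_real .
qed

section \<open>Expansion by the transposed matrices\<close>

lemma matrix_inv_cancel:
  assumes "invertible M"
  shows "M ** matrix_inv M = mat 1" "matrix_inv M ** M = mat 1"
proof -
  have "M ** matrix_inv M = mat 1 \<and> matrix_inv M ** M = mat 1"
    using assms unfolding invertible_def matrix_inv_def by (rule someI_ex)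
  then show "M ** matrix_inv M = mat 1" "matrix_inv M ** M = mat 1" by auto
qed

lemma norm_matrix_ge_smallest_singular_value:
  fixes M :: "real ^ 'd ^ 'd"
  assumes "smallest_singular_value M \<ge> K"
  shows "norm (M *v x) \<ge> K * norm x"
proof (cases "x = 0")
  case False
  define u where "u = (1 / norm x) *\<^sub>R x"
  have u: "norm u = 1" "x = norm x *\<^sub>R u"
    using False by (auto simp: u_def)
  have "smallest_singular_value M \<le> norm (M *v u)"
    unfolding smallest_singular_value_def using u(1)
    by (intro cInf_lower bdd_belowI[of _ 0]) auto
  moreover have "norm (M *v x) = norm x * norm (M *v u)"
    by (subst u(2)) (simp add: matrix_vector_mult_scaleR)
  ultimately show ?thesis
    using assms False by (simp add: mult.commute)
qed simp

text \<open>A square matrix and its transpose have the same smallest singular value. With \<open>y = M\<^sup>-\<^sup>1 x\<close> this follows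
  from \<open>\<parallel>x\<parallel>\<^sup>2 = \<langle>x M, y\<rangle> \<le> \<parallel>x M\<parallel> \<parallel>y\<parallel>\<close> and \<open>K \<parallel>y\<parallel> \<le> \<parallel>x\<parallel>\<close>. The transposed action is
  written as multiplication of row vectors from the right.\<close>

lemma norm_row_vector_matrix_ge:
  fixes M :: "real ^ 'd ^ 'd"
  assumes K: "K > 0" and inv: "invertible M" and M: "\<And>x. norm (M *v x) \<ge> K * norm x"
  shows "norm (x v* M) \<ge> K * norm x"
proof (cases "x = 0")
  case False
  define y where "y = matrix_inv M *v x"
  have y: "M *v y = x"
    unfolding y_def by (simp add: matrix_vector_mul_assoc matrix_inv_cancel[OF inv])
  have "norm x * (K * norm y) \<le> norm x * norm x"
    using M[of y] y by (intro mult_left_mono) auto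
  also have "\<dots> = (x v* M) \<bullet> y"
    by (simp add: y dot_lmul_matrix dot_square_norm power2_eq_square)
  also have "\<dots> \<le> norm (x v* M) * norm y"
    by (rule norm_cauchy_schwarz)
  finally have "norm y * (K * norm x) \<le> norm y * norm (x v* M)"
    by (simp add: mult_ac)
  moreover have "norm y > 0"
    using False y by auto
  ultimately show ?thesis
    by (rule mult_left_le_imp_le)
qed simp

context
  fixes A :: "nat \<Rightarrow> real ^ 'd ^ 'd" and K :: real
  assumes A0: "A 0 = mat 1"
    and K: "K > 1"
    and inv: "\<And>n. invertible (A n)"
    and growth: "\<And>n. smallest_singular_value (A (Suc n) ** matrix_inv (A n)) \<ge> K"
begin

text \<open>The quotient telescopes into \<open>k\<close> factors \<open>A (j + 1) (A j)\<^sup>-\<^sup>1\<close>. A row vector meets the factor with the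
  largest index first, hence the induction peels off that one.\<close>

lemma row_vector_quotient_expands: "norm (x v* (A (n + k) ** matrix_inv (A n))) \<ge> K ^ k * norm x"
proof (induction k arbitrary: x)
  case 0
  show ?case by (simp add: matrix_inv_cancel[OF inv])
next
  case (Suc k)
  define M where "M = A (Suc (n + k)) ** matrix_inv (A (n + k))"
  have "invertible (matrix_inv (A (n + k)))"
    unfolding invertible_def using matrix_inv_cancel[OF inv] by blast
  then have "invertible M"
    unfolding M_def using inv by (intro invertible_mult)
  then have "K * norm x \<le> norm (x v* M)"
    using K growth by (intro norm_row_vector_matrix_ge norm_matrix_ge_smallest_singular_value) (auto simp: M_def)
  then have "K ^ k * (K * norm x) \<le> K ^ k * norm (x v* M)"
    using K by (intro mult_left_mono) auto
  also have "\<dots> \<le> norm ((x v* M) v* (A (n + k) ** matrix_inv (A n)))"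
    by (rule Suc)
  also have "(x v* M) v* (A (n + k) ** matrix_inv (A n)) = x v* (A (n + Suc k) ** matrix_inv (A n))"
  proof -
    have "M ** A (n + k) = A (n + Suc k)"
      unfolding M_def by (simp add: matrix_mul_assoc[symmetric] matrix_inv_cancel[OF inv])
    then show ?thesis
      by (simp add: vector_matrix_mul_assoc matrix_mul_assoc)
  qed
  finally show ?case
    by (simp add: mult_ac)
qed

lemma row_vector_expands: "norm (x v* A k) \<ge> K ^ k * norm x"
proof -
  have "matrix_inv (A 0) = mat 1"
    using matrix_inv_cancel(2)[OF inv, of 0] by (simp add: A0)
  then show ?thesis
    using row_vector_quotient_expands[of k x 0] by simp
qed

text \<open>Factoring \<open>A n - A m = (W - 1) A m\<close> with \<open>W = A n (A m)\<^sup>-\<^sup>1\<close> gives a lower bound by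
  \<open>(K\<^bsup>n-m\<^esup> - 1) K\<^sup>m = K\<^sup>n - K\<^sup>m\<close>, which is at least \<open>K\<^sup>n - K\<^bsup>n-1\<^esup>\<close>, independently of \<open>m\<close>.\<close>

lemma row_vector_difference_expands:
  assumes "m < n"
  shows "norm (x v* (A n - A m)) \<ge> K ^ n * (1 - 1 / K) * norm x"
proof -
  define W where "W = A n ** matrix_inv (A m)"
  have "W ** A m = A n"
    unfolding W_def by (simp add: matrix_mul_assoc[symmetric] matrix_inv_cancel[OF inv])
  then have "x v* (A n - A m) = (x v* W - x) v* A m"
    by (simp add: vector_matrix_mul_assoc algebra_simps)
  then have "K ^ m * norm (x v* W - x) \<le> norm (x v* (A n - A m))"
    using row_vector_expands by simp
  moreover have "(K ^ (n - m) - 1) * norm x \<le> norm (x v* W - x)"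
    using row_vector_quotient_expands[of "n - m" x m] assms norm_triangle_ineq2[of "x v* W" x]
    by (simp add: W_def algebra_simps)
  then have "K ^ m * ((K ^ (n - m) - 1) * norm x) \<le> K ^ m * norm (x v* W - x)"
    using K by (intro mult_left_mono) auto
  moreover have "K ^ n * (1 - 1 / K) \<le> K ^ m * (K ^ (n - m) - 1)"
  proof -
    have "K ^ m * K ^ (n - m) = K ^ n"
      using assms by (simp flip: power_add)
    moreover have "K ^ m \<le> K ^ (n - 1)"
      using K assms by (intro power_increasing) auto
    moreover have "K ^ (n - 1) = K ^ n / K"
      using K assms by (cases n) auto
    ultimately show ?thesis
      by (simp add: algebra_simps)
  qed
  then have "K ^ n * (1 - 1 / K) * norm x \<le> K ^ m * (K ^ (n - m) - 1) * norm x"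
    by (intro mult_right_mono) auto
  ultimately show ?thesis
    unfolding mult.assoc by linarith
qed

end

section \<open>Fourier decay along an exponentially growing sequence\<close>

text \<open>At a frequency of size \<open>K\<^sup>n\<close> up to a constant factor, the logarithm is of order \<open>n\<close>, so a power of the
  logarithm becomes a power of \<open>n\<close>. The finitely many small \<open>n\<close> are absorbed into the constant,
  since the transform of a probability measure is bounded by 1.\<close>

lemma fourier_decay_exponential_scale:
  fixes \<mu> :: "(real ^ 'd) measure"
  assumes \<mu>: "prob_space \<mu>" and K: "K > 1" and s: "s > 0"
    and decay: "(\<lambda>t. cmod (fourier_transform \<mu> t))
           \<in> O[filtercomap infnorm at_top](\<lambda>t. (ln (infnorm t)) powr (- s))"
  obtains C where "0 \<le> C"
    "\<And>n t. 1 \<le> n \<Longrightarrow> K ^ n * (1 - 1 / K) \<le> norm t \<Longrightarrow> cmod (fourier_transform \<mu> t) \<le> C * real n powr (- s)"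
proof -
  obtain c where c: "c > 0" "\<forall>\<^sub>F t in filtercomap infnorm at_top.
      norm (cmod (fourier_transform \<mu> t)) \<le> c * norm (ln (infnorm t) powr (- s))"
    using landau_o.bigE[OF decay] by blast
  then obtain T where T: "\<And>t. T \<le> infnorm t \<Longrightarrow>
      cmod (fourier_transform \<mu> t) \<le> c * ln (infnorm t) powr (- s)"
    unfolding eventually_filtercomap_at_top_linorder by auto
  \<comment> \<open>The factor \<open>b\<close> includes the passage from the Euclidean to the maximum norm; from \<open>n0\<close> on, it costs at most half of the logarithm.\<close>
  define b where "b = (1 - 1 / K) / sqrt (DIM(real ^ 'd))"
  have b: "b > 0"
    using K by (auto simp: b_def)
  have "filterlim (\<lambda>n. K ^ n * b) at_top sequentially"
    using K b by real_asymp
  moreover have "filterlim (\<lambda>n. real n * ln K / 2 + ln b) at_top sequentially"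
    using K by real_asymp
  ultimately have "\<forall>\<^sub>F n in sequentially. T \<le> K ^ n * b \<and> 0 \<le> real n * ln K / 2 + ln b"
    by (auto simp: filterlim_at_top intro: eventually_conj)
  then obtain n0 where n0: "\<And>n. n0 \<le> n \<Longrightarrow> T \<le> K ^ n * b \<and> 0 \<le> real n * ln K / 2 + ln b"
    unfolding eventually_sequentially by blast
  define C where "C = c * (ln K / 2) powr (- s) + real n0 powr s"
  show thesis
  proof
    show "0 \<le> C"
      using c by (simp add: C_def)
    fix n :: nat and t :: "real ^ 'd"
    assume n: "1 \<le> n" and t: "K ^ n * (1 - 1 / K) \<le> norm t"
    show "cmod (fourier_transform \<mu> t) \<le> C * real n powr (- s)"
    proof (cases "n0 \<le> n")
      case True
      have "K ^ n * (1 - 1 / K) \<le> sqrt (DIM(real ^ 'd)) * infnorm t"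
        using t norm_le_infnorm[of t] by linarith
      then have large: "K ^ n * b \<le> infnorm t"
        by (simp add: b_def field_simps)
      have "real n * ln K / 2 \<le> real n * ln K + ln b"
        using n0[OF True] by simp
      also have "\<dots> = ln (K ^ n * b)"
        using K b by (simp add: ln_mult ln_realpow)
      also have "\<dots> \<le> ln (infnorm t)"
        using large K b by (subst ln_le_cancel_iff) (auto intro: less_le_trans[OF _ large])
      finally have "ln (infnorm t) powr (- s) \<le> (real n * ln K / 2) powr (- s)"
        using n K s by (intro powr_mono2') auto
      also have "\<dots> = (ln K / 2) powr (- s) * real n powr (- s)"
        using K n by (subst powr_mult[symmetric]) (auto simp: mult_ac)
      finally have "c * ln (infnorm t) powr (- s) \<le> c * ((ln K / 2) powr (- s) * real n powr (- s))"
        using c by (intro mult_left_mono) auto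
      moreover have "cmod (fourier_transform \<mu> t) \<le> c * ln (infnorm t) powr (- s)"
        using n0[OF True] large by (intro T) linarith
      moreover have "0 \<le> real n0 powr s * real n powr (- s)"
        by simp
      ultimately show ?thesis
        unfolding C_def distrib_right mult.assoc by linarith
    next
      case False
      have "1 = real n powr s * real n powr (- s)"
        using n by (simp flip: powr_add)
      also have "\<dots> \<le> real n0 powr s * real n powr (- s)"
        using False s by (intro mult_right_mono powr_mono2) auto
      also have "\<dots> \<le> C * real n powr (- s)"
        using c by (intro mult_right_mono) (auto simp: C_def)
      finally show ?thesis
        using norm_fourier_transform_le_1[OF \<mu>, of t] by linarith
    qed
  qed
qed


section \<open>Boxes on the torus\<close>

lemma continuous_on_int_dist: "continuous_on UNIV int_dist"
  unfolding int_dist_def by (intro continuous_intros)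

lemma borel_measurable_int_dist [measurable]: "int_dist \<in> borel_measurable borel"
  by (intro borel_measurable_continuous_onI continuous_on_int_dist)

lemma borel_unit_cube [measurable]: "unit_cube \<in> sets (borel :: (real ^ 'd) measure)"
  unfolding unit_cube_def by measurable

lemma prod_Basis_vec:
  "(\<Prod>b\<in>(Basis :: (real ^ 'd) set). g b) = (\<Prod>i\<in>UNIV. g (axis i 1))"
proof -
  have Basis: "(Basis :: (real ^ 'd) set) = range (\<lambda>i. axis i 1)"
    by (auto simp: Basis_vec_def)
  have "inj (\<lambda>i. axis i 1 :: real ^ 'd)"
    by (auto simp: inj_on_def axis_eq_axis)
  then show ?thesis
    unfolding Basis by (subst prod.reindex) auto
qed

text \<open>Fubini for a product set, with the one-dimensional measures supplied as integrals over \<open>[0, 1]\<close>.\<close>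

lemma emeasure_lborel_cube_product:
  fixes P :: "'d :: finite \<Rightarrow> real \<Rightarrow> bool"
  assumes [measurable]: "\<And>i. Measurable.pred borel (P i)"
    and I: "\<And>i. ((\<lambda>x. of_bool (P i x)) has_integral I i) {0..1}"
  shows "emeasure lborel {x :: real ^ 'd. x \<in> unit_cube \<and> (\<forall>i. P i (x $ i))} = ennreal (\<Prod>i\<in>UNIV. I i)"
proof -
  define g :: "'d \<Rightarrow> real \<Rightarrow> ennreal" where "g i x = indicator {x. 0 \<le> x \<and> x < 1 \<and> P i x} x" for i x
  \<comment> \<open>The product formula for Lebesgue measure is indexed by basis vectors instead of coordinates.\<close>
  define G :: "real ^ 'd \<Rightarrow> real \<Rightarrow> ennreal" where "G b = g (THE i. b = axis i 1)" for b
  have G: "G (axis i 1) = g i" for i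
    by (simp add: G_def axis_eq_axis)
  have [measurable]: "g i \<in> borel_measurable borel" for i
    unfolding g_def by measurable
  have g_integral: "integral\<^sup>N lborel (g i) = ennreal (I i)" for i
  proof -
    have "integral\<^sup>N lborel (g i) = (\<integral>\<^sup>+x\<in>{0..1}. ennreal (of_bool (P i x)) \<partial>lborel)"
      by (intro nn_integral_cong_AE eventually_mono[OF AE_lborel_singleton[of 1]])
        (auto simp: g_def indicator_def)
    also have "\<dots> = ennreal (I i)"
      by (intro nn_integral_has_integral_lebesgue' I) auto
    finally show ?thesis .
  qed
  have I_nonneg: "0 \<le> I i" for i
    by (rule has_integral_nonneg[OF I]) auto
  have "emeasure lborel {x :: real ^ 'd. x \<in> unit_cube \<and> (\<forall>i. P i (x $ i))}
      = (\<integral>\<^sup>+x. indicator {x :: real ^ 'd. x \<in> unit_cube \<and> (\<forall>i. P i (x $ i))} x \<partial>lborel)"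
    by (intro nn_integral_indicator[symmetric]) measurable
  also have "\<dots> = (\<integral>\<^sup>+x. (\<Prod>b\<in>Basis. G b (x \<bullet> b)) \<partial>lborel)"
  proof (intro nn_integral_cong)
    fix x :: "real ^ 'd"
    have "(\<Prod>b\<in>Basis. G b (x \<bullet> b)) = (\<Prod>i\<in>UNIV. indicator {x. 0 \<le> x \<and> x < 1 \<and> P i x} (x $ i))"
      by (simp add: prod_Basis_vec G g_def inner_axis)
    also have "\<dots> = indicator {x. x \<in> unit_cube \<and> (\<forall>i. P i (x $ i))} x"
      by (auto simp: unit_cube_def indicator_def)
    finally show "indicator {x. x \<in> unit_cube \<and> (\<forall>i. P i (x $ i))} x = (\<Prod>b\<in>Basis. G b (x \<bullet> b))"
      by simp
  qed
  also have "\<dots> = (\<Prod>b\<in>Basis. integral\<^sup>N lborel (G b))"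
    by (intro nn_integral_lborel_prod) (auto simp: G_def)
  also have "\<dots> = ennreal (\<Prod>i\<in>UNIV. I i)"
    using I_nonneg by (simp add: prod_Basis_vec G g_integral prod_ennreal)
  finally show ?thesis .
qed

definition torus_box :: "real ^ 'd \<Rightarrow> real ^ 'd \<Rightarrow> (real ^ 'd) set" where
  "torus_box v \<rho> = {\<beta> \<in> unit_cube. \<forall>i. int_dist (\<beta> $ i - v $ i) \<le> \<rho> $ i}"

lemma borel_torus_box [measurable]: "torus_box v \<rho> \<in> sets borel"
  unfolding torus_box_def by measurable

lemma emeasure_torus_box:
  assumes "\<And>i. 0 < \<rho> $ i \<and> \<rho> $ i < 1 / 2"
  shows "emeasure lborel (torus_box v \<rho>) = ennreal (\<Prod>i\<in>UNIV. 2 * \<rho> $ i)"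
  unfolding torus_box_def using assms
  by (subst emeasure_lborel_cube_product[OF _ has_integral_arc]) auto

lemma emeasure_torus_box_Int:
  assumes \<rho>: "\<And>i. 0 < \<rho> $ i \<and> \<rho> $ i < 1 / 2" and \<tau>: "\<And>i. 0 < \<tau> $ i \<and> \<tau> $ i < 1 / 2"
  shows "emeasure lborel (torus_box v \<rho> \<inter> torus_box w \<tau>)
    = ennreal (\<Prod>i\<in>UNIV. arc_overlap (\<rho> $ i) (\<tau> $ i) ((w - v) $ i))"
proof -
  have "torus_box v \<rho> \<inter> torus_box w \<tau> = {\<beta>. \<beta> \<in> unit_cube \<and>
      (\<forall>i. int_dist (\<beta> $ i - v $ i) \<le> \<rho> $ i \<and> int_dist (\<beta> $ i - w $ i) \<le> \<tau> $ i)}"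
    by (auto simp: torus_box_def)
  then show ?thesis
    using \<rho> \<tau> by (simp only:) (subst emeasure_lborel_cube_product[OF _ has_integral_arc_overlap], auto)
qed

lemma arc_overlap_nonneg:
  assumes "0 < r" "r < 1 / 2" "0 < q" "q < 1 / 2"
  shows "0 \<le> arc_overlap r q y"
  using has_integral_nonneg[OF has_integral_arc_overlap[OF assms, of 0 y]] by simp

text \<open>The set in question is the limit superior of a sequence of boxes. Shifting the index by one matches
  the sequence that starts at \<open>n = 1\<close> with sequences indexed by all natural numbers.\<close>

lemma twisted_set_eq_limsup_torus_box:
  "twisted_set A r \<alpha> = {\<beta> \<in> unit_cube.
     infinite {n. \<beta> \<in> torus_box (real_matrix (A (Suc n)) *v \<alpha>) (r (Suc n))}}"
proof -
  have "infinite {n. n \<ge> 1 \<and> (\<exists>\<rho> \<in> target r n. cong_mod_1 (real_matrix (A n) *v \<alpha>) (\<beta> + \<rho>))}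
    \<longleftrightarrow> infinite {n. \<beta> \<in> torus_box (real_matrix (A (Suc n)) *v \<alpha>) (r (Suc n))}"
    if "\<beta> \<in> unit_cube" for \<beta>
  proof -
    have "int_dist (a - b) = int_dist (b - a)" for a b
      using int_dist_minus[of "a - b"] by simp
    then have "{n. n \<ge> 1 \<and> (\<exists>\<rho> \<in> target r n. cong_mod_1 (real_matrix (A n) *v \<alpha>) (\<beta> + \<rho>))}
      = Suc ` {n. \<beta> \<in> torus_box (real_matrix (A (Suc n)) *v \<alpha>) (r (Suc n))}"
      using that by (auto simp: target_cong_iff torus_box_def image_iff Suc_le_eq gr0_conv_Suc)
    then show ?thesis
      by (simp add: finite_image_iff)
  qed
  then show ?thesis
    unfolding twisted_set_def by auto
qed


section \<open>The zero-one law\<close>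

theorem corollary7:
  fixes r :: "nat \<Rightarrow> real ^ 'd"
    and \<mu> :: "(real ^ 'd) measure"
    and A :: "nat \<Rightarrow> int ^ 'd ^ 'd"
    and K s :: real
  assumes "\<And>n i. n \<ge> 1 \<Longrightarrow> 0 < r n $ i \<and> r n $ i < 1 / 2"
    and "prob_space \<mu>"
    and "sets \<mu> = sets (restrict_space borel unit_cube)"
    and "A 0 = mat 1"
    and "K > 1"
    and "\<And>n. invertible (real_matrix (A n))"
    and "\<And>n. smallest_singular_value (real_matrix (A (Suc n)) ** matrix_inv (real_matrix (A n))) \<ge> K"
    and "s > real CARD('d) + 1"
    and "(\<lambda>t. cmod (fourier_transform \<mu> t))
           \<in> O[filtercomap infnorm at_top](\<lambda>t. (ln (infnorm t)) powr (- s))"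
  shows "AE \<alpha> in \<mu>. emeasure lebesgue (twisted_set A r \<alpha>) =
           (if summable (\<lambda>n. \<Prod>i\<in>UNIV. r (Suc n) $ i) then 0 else 1)"
proof -
  interpret prob_space \<mu> by fact
  have r: "0 < r (Suc n) $ i \<and> r (Suc n) $ i < 1 / 2" for n i
    using assms(1) by simp
  define B where "B n = real_matrix (A n)" for n
  define \<psi> where "\<psi> n = (\<Prod>i\<in>UNIV. 2 * r (Suc n) $ i)" for n
  have \<psi>_eq: "\<psi> n = 2 ^ CARD('d) * (\<Prod>i\<in>UNIV. r (Suc n) $ i)" for n
    by (simp add: \<psi>_def prod.distrib)
  have \<psi>_nonneg: "0 \<le> \<psi> n" for n
    unfolding \<psi>_def using r by (intro prod_nonneg) (auto intro: less_imp_le)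
  define \<Lambda> :: "(real ^ 'd) measure" where "\<Lambda> = restrict_space lborel unit_cube"
  have space_\<Lambda>: "space \<Lambda> = unit_cube"
    by (simp add: \<Lambda>_def space_restrict_space)
  have emeasure_\<Lambda>: "emeasure \<Lambda> X = emeasure lborel X" if "X \<subseteq> unit_cube" for X
    unfolding \<Lambda>_def using that by (intro emeasure_restrict_space) auto
  have sets_\<Lambda>: "X \<in> sets \<Lambda>" if "X \<in> sets borel" "X \<subseteq> unit_cube" for X
    unfolding \<Lambda>_def using that by (auto simp: sets_restrict_space image_iff)
  have "emeasure lborel (unit_cube :: (real ^ 'd) set) = 1"
    using emeasure_lborel_cube_product[of "\<lambda>_ _. True" "\<lambda>_ :: 'd. 1"]
      has_integral_const_real[of "1 :: real" 0 1] by simp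
  then interpret \<Lambda>: prob_space \<Lambda>
    by (intro prob_spaceI) (simp add: space_\<Lambda> emeasure_\<Lambda>)
  define Box where "Box \<alpha> n = torus_box (B (Suc n) *v \<alpha>) (r (Suc n))" for \<alpha> n
  have Box_subset: "Box \<alpha> n \<subseteq> unit_cube" for \<alpha> n
    by (auto simp: Box_def torus_box_def)
  have Box_sets: "Box \<alpha> n \<in> sets \<Lambda>" for \<alpha> n
    using Box_subset by (intro sets_\<Lambda>) (auto simp: Box_def)
  have twisted: "twisted_set A r \<alpha> = {\<beta> \<in> space \<Lambda>. infinite {n. \<beta> \<in> Box \<alpha> n}}" for \<alpha>
    by (simp add: twisted_set_eq_limsup_torus_box Box_def B_def space_\<Lambda>)
  have twisted_borel: "twisted_set A r \<alpha> \<in> sets borel" for \<alpha>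
    unfolding twisted space_\<Lambda> Box_def infinite_nat_iff_unbounded_le by measurable
  have twisted_subset: "twisted_set A r \<alpha> \<subseteq> unit_cube" for \<alpha>
    by (auto simp: twisted space_\<Lambda>)
  have twisted_sets: "twisted_set A r \<alpha> \<in> sets \<Lambda>" for \<alpha>
    by (rule sets_\<Lambda>[OF twisted_borel twisted_subset])
  have lebesgue_eq: "emeasure lebesgue (twisted_set A r \<alpha>) = emeasure \<Lambda> (twisted_set A r \<alpha>)" for \<alpha>
    by (simp add: emeasure_\<Lambda> twisted_subset twisted_borel)
  have measure_Box: "emeasure \<Lambda> (Box \<alpha> n) = ennreal (\<psi> n)" for \<alpha> n
    using Box_subset r by (simp add: emeasure_\<Lambda> Box_def \<psi>_def emeasure_torus_box)
  show ?thesis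
  proof (cases "summable (\<lambda>n. \<Prod>i\<in>UNIV. r (Suc n) $ i)")
    case True
    then have "summable \<psi>"
      unfolding \<psi>_eq by (rule summable_mult)
    have "emeasure \<Lambda> (twisted_set A r \<alpha>) = 0" for \<alpha>
    proof -
      have "AE \<beta> in \<Lambda>. eventually (\<lambda>n. \<beta> \<in> space \<Lambda> - Box \<alpha> n) sequentially"
        using \<open>summable \<psi>\<close> \<psi>_nonneg Box_sets
        by (intro borel_cantelli_AE1) (auto simp: measure_Box measure_def)
      then have "AE \<beta> in \<Lambda>. \<beta> \<notin> twisted_set A r \<alpha>"
      proof eventually_elim
        case (elim \<beta>)
        then obtain N where "\<And>n. N \<le> n \<Longrightarrow> \<beta> \<notin> Box \<alpha> n"
          unfolding eventually_sequentially by auto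
        then have "{n. \<beta> \<in> Box \<alpha> n} \<subseteq> {..<N}"
          by (auto simp: not_le[symmetric])
        then have "finite {n. \<beta> \<in> Box \<alpha> n}"
          by (rule finite_subset) simp
        then show ?case by (simp add: twisted)
      qed
      then show ?thesis
        using twisted_sets[of \<alpha>] by (simp add: AE_iff_measurable[OF twisted_sets] twisted)
    qed
    with True show ?thesis
      by (simp add: lebesgue_eq)
  next
    case False
    interpret pair: pair_prob_space \<mu> \<Lambda> ..
    define M where "M = \<mu> \<Otimes>\<^sub>M \<Lambda>"
    define E where "E n = {x \<in> space M. snd x \<in> Box (fst x) n}" for n
    have [measurable]: "(\<lambda>x. x) \<in> measurable \<mu> borel"
      using measurable_restrict_space1[of "\<lambda>x. x" borel borel unit_cube]
        measurable_cong_sets[OF assms(3) refl] by auto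
    have [measurable]: "(\<lambda>x. x) \<in> measurable \<Lambda> borel"
      unfolding \<Lambda>_def by (intro measurable_restrict_space1) auto
    have fst_M [measurable]: "fst \<in> measurable M borel"
      using measurable_compose[OF measurable_fst[of \<mu> \<Lambda>], of "\<lambda>x. x" borel] by (simp add: M_def)
    have snd_M [measurable]: "snd \<in> measurable M borel"
      using measurable_compose[OF measurable_snd[of \<mu> \<Lambda>], of "\<lambda>x. x" borel] by (simp add: M_def)
    have component [measurable]: "(\<lambda>\<alpha>. (C *v \<alpha>) $ i) \<in> borel_measurable borel"
      for C :: "real ^ 'd ^ 'd" and i
      by (intro borel_measurable_continuous_onI continuous_intros linear_continuous_on)
        (auto intro: matrix_vector_mul_bounded_linear)
    have nth: "(\<lambda>x :: real ^ 'd. x $ i) \<in> borel_measurable borel" for i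
      by measurable
    have E_events [measurable]: "E n \<in> sets M" for n
    proof -
      have [measurable]: "(\<lambda>x. snd x $ i) \<in> borel_measurable M"
        "(\<lambda>x. (B (Suc n) *v fst x) $ i) \<in> borel_measurable M" for i
        by (rule measurable_compose[OF snd_M nth], rule measurable_compose[OF fst_M component])
      have "snd x \<in> unit_cube" if "x \<in> space M" for x
        using that by (auto simp: M_def space_pair_measure space_\<Lambda>)
      then have "E n = {x \<in> space M. \<forall>i. int_dist (snd x $ i - (B (Suc n) *v fst x) $ i) \<le> r (Suc n) $ i}"
        by (auto simp: E_def Box_def torus_box_def)
      also have "\<dots> \<in> sets M"
        by measurable
      finally show ?thesis .
    qed
    have slice: "Pair \<alpha> -` E n = Box \<alpha> n" if "\<alpha> \<in> space \<mu>" for \<alpha> n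
      using that Box_subset[of \<alpha> n] by (auto simp: E_def M_def space_pair_measure space_\<Lambda>)
    have prob_E: "measure M (E n) = \<psi> n" for n
    proof -
      have "emeasure M (E n) = (\<integral>\<^sup>+\<alpha>. emeasure \<Lambda> (Pair \<alpha> -` E n) \<partial>\<mu>)"
        unfolding M_def using E_events by (intro \<Lambda>.emeasure_pair_measure_alt) (auto simp: M_def)
      also have "\<dots> = (\<integral>\<^sup>+\<alpha>. ennreal (\<psi> n) \<partial>\<mu>)"
        by (intro nn_integral_cong) (simp add: slice measure_Box)
      finally show ?thesis
        using \<psi>_nonneg by (simp add: measure_def emeasure_space_1)
    qed
    obtain C where C: "0 \<le> C" "\<And>n t. 1 \<le> n \<Longrightarrow> K ^ n * (1 - 1 / K) \<le> norm t \<Longrightarrow>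
        cmod (fourier_transform \<mu> t) \<le> C * real n powr (- s)"
    proof (rule fourier_decay_exponential_scale[OF assms(2,5) _ assms(9)])
      show "0 < s" using assms(8) by linarith
    qed (rule that)
    \<comment> \<open>The correlation bound that the Fourier expansion and the decay give together; the index shift turns \<open>n\<close> into \<open>Suc n\<close>.\<close>
    define c where "c n = (4 / 3) ^ CARD('d) * (C * real (Suc n) powr (- s))" for n
    have corr: "measure M (E m \<inter> E n) \<le> measure M (E m) * measure M (E n) + c n" if "m < n" for m n
    proof -
      \<comment> \<open>The volume of the overlap of the two slices at \<open>\<alpha>\<close>.\<close>
      define h where "h \<alpha> = (\<Prod>i\<in>UNIV. arc_overlap (r (Suc m) $ i) (r (Suc n) $ i) (((B (Suc n) - B (Suc m)) *v \<alpha>) $ i))" for \<alpha>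
      have h_nonneg: "0 \<le> h \<alpha>" for \<alpha>
        unfolding h_def using r by (intro prod_nonneg ballI arc_overlap_nonneg) auto
      have h_meas: "h \<in> borel_measurable \<mu>"
        unfolding h_def
        by (intro borel_measurable_prod measurable_compose[OF _ borel_measurable_arc_overlap]
          measurable_compose[OF \<open>(\<lambda>x. x) \<in> measurable \<mu> borel\<close> component])
      have "h \<alpha> \<le> (\<Prod>i\<in>(UNIV :: 'd set). 4 / 3)" for \<alpha>
        unfolding h_def
      proof (intro prod_mono conjI)
        fix i
        show "0 \<le> arc_overlap (r (Suc m) $ i) (r (Suc n) $ i) (((B (Suc n) - B (Suc m)) *v \<alpha>) $ i)"
          using r by (intro arc_overlap_nonneg) auto
        show "arc_overlap (r (Suc m) $ i) (r (Suc n) $ i) (((B (Suc n) - B (Suc m)) *v \<alpha>) $ i) \<le> 4 / 3"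
          using r by (intro order_trans[OF abs_ge_self abs_arc_overlap_le]) auto
      qed
      then have h_int: "integrable \<mu> h"
        using h_nonneg h_meas by (intro integrable_const_bound[where B = "\<Prod>i\<in>(UNIV :: 'd set). 4 / 3"]) auto
      have "emeasure M (E m \<inter> E n) = (\<integral>\<^sup>+\<alpha>. emeasure \<Lambda> (Pair \<alpha> -` (E m \<inter> E n)) \<partial>\<mu>)"
        unfolding M_def using E_events by (intro \<Lambda>.emeasure_pair_measure_alt) (auto simp: M_def)
      also have "\<dots> = (\<integral>\<^sup>+\<alpha>. ennreal (h \<alpha>) \<partial>\<mu>)"
      proof (rule nn_integral_cong)
        fix \<alpha> assume \<alpha>: "\<alpha> \<in> space \<mu>"
        have "emeasure \<Lambda> (Box \<alpha> m \<inter> Box \<alpha> n) = ennreal (h \<alpha>)"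
          using r Box_subset[of \<alpha> m]
          by (subst emeasure_\<Lambda>)
            (auto simp: Box_def emeasure_torus_box_Int h_def matrix_vector_mult_diff_rdistrib)
        then show "emeasure \<Lambda> (Pair \<alpha> -` (E m \<inter> E n)) = ennreal (h \<alpha>)"
          using \<alpha> by (simp add: slice)
      qed
      also have "\<dots> = ennreal (LINT \<alpha>|\<mu>. h \<alpha>)"
        using h_int h_nonneg by (intro nn_integral_eq_integral) auto
      finally have "measure M (E m \<inter> E n) = (LINT \<alpha>|\<mu>. h \<alpha>)"
        using h_nonneg by (simp add: measure_def integral_nonneg_AE)
      moreover have "\<bar>(LINT \<alpha>|\<mu>. h \<alpha>) - (\<Prod>i\<in>UNIV. 4 * r (Suc m) $ i * r (Suc n) $ i)\<bar> \<le> c n"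
        unfolding h_def c_def
      proof (rule integral_prod_arc_overlap[OF assms(2,3) r r])
        fix f :: "'d \<Rightarrow> int" assume "f \<noteq> (\<lambda>_. 0)"
        then obtain i where "f i \<noteq> 0" by auto
        then have "1 \<le> \<bar>(\<chi> i. real_of_int (f i)) $ i\<bar>"
          by simp
        also have "\<dots> \<le> norm (\<chi> i. real_of_int (f i))"
          by (rule component_le_norm_cart)
        finally have "K ^ Suc n * (1 - 1 / K) * 1 \<le> K ^ Suc n * (1 - 1 / K) * norm (\<chi> i. real_of_int (f i))"
          using assms(5) by (intro mult_left_mono) auto
        also have "\<dots> \<le> norm ((\<chi> i. real_of_int (f i)) v* (B (Suc n) - B (Suc m)))"
        proof (rule row_vector_difference_expands)
          show "B 0 = mat 1"
            by (simp add: B_def assms(4) vec_eq_iff map_matrix_def mat_def)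
        qed (use assms \<open>m < n\<close> in \<open>auto simp: B_def\<close>)
        finally show "cmod (fourier_transform \<mu> ((\<chi> i. of_int (f i)) v* (B (Suc n) - B (Suc m))))
            \<le> C * real (Suc n) powr (- s)"
          by (intro C(2)) auto
      qed
      moreover have "(\<Prod>i\<in>UNIV. 4 * r (Suc m) $ i * r (Suc n) $ i) = \<psi> m * \<psi> n"
        unfolding \<psi>_def by (subst prod.distrib[symmetric]) (simp add: mult_ac)
      ultimately show ?thesis
        by (simp add: prob_E)
    qed
    have "summable (\<lambda>n. real n * c n)"
    proof (rule summable_comparison_test')
      show "summable (\<lambda>n. (4 / 3) ^ CARD('d) * C * real (Suc n) powr (1 - s))"
      proof (intro summable_mult)
        have "1 - s < - 1"
          using assms(8) zero_less_card_finite[where 'a = 'd] by linarith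
        then have "summable (\<lambda>n. real n powr (1 - s))"
          by (simp add: summable_real_powr_iff)
        then show "summable (\<lambda>n. real (Suc n) powr (1 - s))"
          by (subst summable_Suc_iff)
      qed
      fix n :: nat
      have "real n * real (Suc n) powr (- s) \<le> real (Suc n) * real (Suc n) powr (- s)"
        by (intro mult_right_mono) auto
      also have "\<dots> = real (Suc n) powr (1 - s)"
        by (simp add: powr_diff powr_minus divide_inverse del: of_nat_Suc)
      finally have "(4 / 3) ^ CARD('d) * C * (real n * real (Suc n) powr (- s))
          \<le> (4 / 3) ^ CARD('d) * C * real (Suc n) powr (1 - s)"
        using C(1) by (intro mult_left_mono) auto
      then show "norm (real n * c n) \<le> (4 / 3) ^ CARD('d) * C * real (Suc n) powr (1 - s)"
        using C(1) by (simp add: c_def mult_ac del: of_nat_Suc)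
    qed
    moreover have "\<not> summable (\<lambda>n. measure M (E n))"
      using False by (simp add: prob_E \<psi>_eq summable_cmult_iff)
    moreover have "prob_space M"
      unfolding M_def by (rule pair.prob_space_axioms)
    ultimately have "AE x in M. infinite {n. x \<in> E n}"
      using corr E_events by (intro prob_space.AE_infinitely_often_if_almost_pairwise_independent)
    then have "AE \<alpha> in \<mu>. AE \<beta> in \<Lambda>. infinite {n. (\<alpha>, \<beta>) \<in> E n}"
      unfolding M_def by (rule pair.AE_pair)
    then show ?thesis
      using AE_space[of \<mu>]
    proof eventually_elim
      case (elim \<alpha>)
      from elim(1) AE_space[of \<Lambda>] have "AE \<beta> in \<Lambda>. \<beta> \<in> twisted_set A r \<alpha>"
      proof eventually_elim
        case (elim \<beta>)
        have "(\<alpha>, \<beta>) \<in> E n \<longleftrightarrow> \<beta> \<in> Box \<alpha> n" for n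
          using slice[OF \<open>\<alpha> \<in> space \<mu>\<close>, of n] by auto
        with elim show ?case by (simp add: twisted)
      qed
      then have "emeasure \<Lambda> (twisted_set A r \<alpha>) = 1"
        using twisted_sets by (intro \<Lambda>.emeasure_eq_1_AE)
      with False show ?case
        by (simp add: lebesgue_eq)
    qed
  qed
qed

end
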